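(* Let $f:\mathbf{R}^N\to\mathbf{R}$ be convex and differentiable, let $\hat S$ be a uniform block sampling with $\tau=\mathbf{E}[|\hat S|]>0$, and let $v=(v_1,\dots,v_n)$ with all $v_i>0$ be such that $$\mathbf{E}\left[f(x+h_{[\hat S]})\right]\le f(x)+\frac{\tau}{n}\left(\langle\nabla f(x),h\rangle+\frac12\|h\|_v^2\right)\qquad\text{for all }x,h\in\mathbf{R}^N.$$ Let $\psi:\mathbf{R}^N\to\mathbf{R}\cup\{+\infty\}$, $\psi(x)=\sum_{i=1}^n\psi_i(x^{(i)})$, with each $\psi_i$ convex, and let $F=f+\psi$. Let $x_0\in\operatorname{dom}\psi$, and assume the random sets $S_k$ in the APPROX algorithm (described in the context) are chosen independently, following the distribution of $\hat S$. Then for any minimizer $x_*$ of $F$ over $\mathbf{R}^N$, the iterates $\{x_k\}_{k\ge1}$ of the algorithm satisfy $$\mathbf{E}[F(x_k)-F(x_* )]\le\frac{4n^2}{((k-1)\tau+2n)^2}\,C,$$ where $$C=\left(1-\frac{\tau}{n}\right)(F(x_0)-F(x_* ))+\frac12\|x_0-x_*\|_v^2.$$ In other words, for any $0<\epsilon\le C$, the number of iterations for obtaining an $\epsilon$-solution in expectation does not exceed $$k=\left\lceil\frac{2n}{\tau}\left(\sqrt{\frac{C}{\epsilon}}-1\right)+1\right\rceil,$$ i.e. for this $k$ one has $\mathbf{E}[F(x_k)-F(x_* )]\le\epsilon$.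
   Context: Blocks: $N=N_1+\dots+N_n$, $[n]=\{1,\dots,n\}$; the $N\times N$ identity matrix is split into column submatrices $U=[U_1,\dots,U_n]$ with $U_i\in\mathbf{R}^{N\times N_i}$. For $x\in\mathbf{R}^N$, $x^{(i)}=U_i^Tx\in\mathbf{R}^{N_i}$. For $S\subseteq[n]$, $h_{[S]}=\sum_{i\in S}U_ih^{(i)}$. $\nabla_if(x)=U_i^T\nabla f(x)$. Norms: for each $i$ a symmetric positive definite matrix $B_i\in\mathbf{R}^{N_i\times N_i}$ is fixed; $\|t\|_{(i)}=\langle B_it,t\rangle^{1/2}$ for $t\in\mathbf{R}^{N_i}$, and $\|x\|_v^2=\sum_{i=1}^nv_i\|x^{(i)}\|_{(i)}^2$. A uniform block sampling is a random subset $\hat S$ of $[n]$ with $\mathbf{P}(i\in\hat S)=\mathbf{P}(j\in\hat S)$ for all $i,j\in[n]$. APPROX algorithm: given $x_0\in\mathbf{R}^N$, set $z_0=x_0$, $\theta_0=\tau/n$. For $k=0,1,2,\dots$: 1. $y_k=(1-\theta_k)x_k+\theta_kz_k$. 2. Generate a random set of blocks $S_k$ distributed as $\hat S$. 3. For $i\notin S_k$ set $z_{k+1}^{(i)}=z_k^{(i)}$; for $i\in S_k$ set $$z_{k+1}^{(i)}=\arg\min_{z\in\mathbf{R}^{N_i}}\left\{\langle\nabla_if(y_k),z-y_k^{(i)}\rangle+\frac{n\theta_kv_i}{2\tau}\|z-z_k^{(i)}\|_{(i)}^2+\psi_i(z)\right\}.$$ 4. $x_{k+1}=y_k+\frac n\tau\theta_k(z_{k+1}-z_k)$.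 5. $\theta_{k+1}=\frac{\sqrt{\theta_k^4+4\theta_k^2}-\theta_k^2}{2}$. The minimizers in step 3 are assumed to exist, so that the algorithm is well defined (e.g. this holds if each $\psi_i$ is proper and lower semicontinuous). *)

theory Defs
  imports "HOL-Probability.Probability"
begin

text \<open>
  The coordinates of \<open>\<real>\<^sup>N\<close> are indexed by the finite type \<open>'m\<close> (so \<open>N = CARD('m)\<close>) and the
  blocks by the finite type \<open>'b\<close> (so \<open>n = CARD('b)\<close>).  A map \<open>blk :: 'm \<Rightarrow> 'b\<close> assigns to each
  coordinate its block, so \<open>N\<^sub>i\<close> is the number of coordinates \<open>j\<close> with \<open>blk j = i\<close>.

  As the block sizes differ, \<open>\<real>\<close> to the power \<open>N\<^sub>i\<close> is identified, via the column submatrix \<open>U\<^sub>i\<close>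
  of the identity, with the vectors of \<open>\<real>\<^sup>N\<close> that vanish off block \<open>i\<close>.  Under this
  identification \<open>U\<^sub>i\<close> is the inclusion and its transpose is \<open>block_part blk i\<close>.
\<close>

definition block_space :: "('m::finite \<Rightarrow> 'b) \<Rightarrow> 'b \<Rightarrow> (real ^ 'm) set" where
  "block_space blk i = {t. \<forall>j. blk j \<noteq> i \<longrightarrow> t $ j = 0}"

definition block_part :: "('m::finite \<Rightarrow> 'b) \<Rightarrow> 'b \<Rightarrow> real ^ 'm \<Rightarrow> real ^ 'm" where
  "block_part blk i x = (\<chi> j. if blk j = i then x $ j else 0)"

definition block_restrict :: "('m::finite \<Rightarrow> 'b) \<Rightarrow> 'b set \<Rightarrow> real ^ 'm \<Rightarrow> real ^ 'm" where
  "block_restrict blk S h = (\<Sum>i\<in>S. block_part blk i h)"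

text \<open>
  A symmetric positive definite matrix of size \<open>N\<^sub>i\<close> is stored in the entries of an \<open>N\<close> by \<open>N\<close>
  matrix whose row and column both lie in block \<open>i\<close>; the other entries are unconstrained and
  do not affect \<open>block_norm\<close> on \<open>block_space blk i\<close>.
\<close>

definition block_spd :: "('m::finite \<Rightarrow> 'b) \<Rightarrow> 'b \<Rightarrow> real ^ 'm ^ 'm \<Rightarrow> bool" where
  "block_spd blk i A \<longleftrightarrow>
     (\<forall>j k. blk j = i \<longrightarrow> blk k = i \<longrightarrow> A $ j $ k = A $ k $ j) \<and>
     (\<forall>t\<in>block_space blk i. t \<noteq> 0 \<longrightarrow> (A *v t) \<bullet> t > 0)"

definition block_norm :: "('b \<Rightarrow> real ^ 'm ^ 'm) \<Rightarrow> 'b \<Rightarrow> real ^ 'm::finite \<Rightarrow> real" where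
  "block_norm B i t = sqrt ((B i *v t) \<bullet> t)"

definition norm_v_sq ::
    "('m::finite \<Rightarrow> 'b::finite) \<Rightarrow> ('b \<Rightarrow> real ^ 'm ^ 'm) \<Rightarrow> ('b \<Rightarrow> real) \<Rightarrow> real ^ 'm \<Rightarrow> real" where
  "norm_v_sq blk B v x = (\<Sum>i\<in>UNIV. v i * (block_norm B i (block_part blk i x))\<^sup>2)"

text \<open>Convexity of a function with values in \<open>\<real> \<union> {+\<infinity>}\<close>; the endpoints \<open>t = 0, 1\<close> are trivial.\<close>

definition ereal_convex_on :: "'a::real_vector set \<Rightarrow> ('a \<Rightarrow> ereal) \<Rightarrow> bool" where
  "ereal_convex_on V g \<longleftrightarrow>
     convex V \<and> (\<forall>x\<in>V. g x \<noteq> - \<infinity>) \<and>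
     (\<forall>x\<in>V. \<forall>y\<in>V. \<forall>t. 0 < t \<and> t < 1 \<longrightarrow>
        g ((1 - t) *\<^sub>R x + t *\<^sub>R y) \<le> ereal (1 - t) * g x + ereal t * g y)"

definition block_sum ::
    "('m::finite \<Rightarrow> 'b::finite) \<Rightarrow> ('b \<Rightarrow> real ^ 'm \<Rightarrow> ereal) \<Rightarrow> real ^ 'm \<Rightarrow> ereal" where
  "block_sum blk \<psi> x = (\<Sum>i\<in>UNIV. \<psi> i (block_part blk i x))"

definition objective ::
    "(real ^ 'm \<Rightarrow> real) \<Rightarrow> ('m::finite \<Rightarrow> 'b::finite) \<Rightarrow> ('b \<Rightarrow> real ^ 'm \<Rightarrow> ereal) \<Rightarrow>
     real ^ 'm \<Rightarrow> ereal" where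
  "objective f blk \<psi> x = ereal (f x) + block_sum blk \<psi> x"

definition uniform_sampling :: "'b::finite set pmf \<Rightarrow> bool" where
  "uniform_sampling Shat \<longleftrightarrow>
     (\<forall>i j. measure_pmf.prob Shat {S. i \<in> S} = measure_pmf.prob Shat {S. j \<in> S})"

primrec approx_theta :: "real \<Rightarrow> nat \<Rightarrow> real" where
  "approx_theta \<theta>\<^sub>0 0 = \<theta>\<^sub>0"
| "approx_theta \<theta>\<^sub>0 (Suc k) =
     (sqrt (approx_theta \<theta>\<^sub>0 k ^ 4 + 4 * (approx_theta \<theta>\<^sub>0 k)\<^sup>2) - (approx_theta \<theta>\<^sub>0 k)\<^sup>2) / 2"

text \<open>
  \<open>approx_run blk gradf \<psi> B v \<tau> x0 Ss x y z\<close>: the sequences \<open>x\<close>, \<open>y\<close>, \<open>z\<close> are produced by the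
  APPROX algorithm from \<open>x0\<close> when \<open>Ss k\<close> is the set of blocks drawn in iteration \<open>k\<close>.  The
  relational form includes the existence of the minimizers in the block updates.
\<close>

definition approx_run ::
    "('m::finite \<Rightarrow> 'b::finite) \<Rightarrow> (real ^ 'm \<Rightarrow> real ^ 'm) \<Rightarrow> ('b \<Rightarrow> real ^ 'm \<Rightarrow> ereal) \<Rightarrow>
     ('b \<Rightarrow> real ^ 'm ^ 'm) \<Rightarrow> ('b \<Rightarrow> real) \<Rightarrow> real \<Rightarrow> real ^ 'm \<Rightarrow> (nat \<Rightarrow> 'b set) \<Rightarrow>
     (nat \<Rightarrow> real ^ 'm) \<Rightarrow> (nat \<Rightarrow> real ^ 'm) \<Rightarrow> (nat \<Rightarrow> real ^ 'm) \<Rightarrow> bool" where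
  "approx_run blk gradf \<psi> B v \<tau> x0 Ss x y z \<longleftrightarrow>
     (let n = real CARD('b); \<theta> = approx_theta (\<tau> / n) in
       x 0 = x0 \<and> z 0 = x0 \<and>
       (\<forall>k. y k = (1 - \<theta> k) *\<^sub>R x k + \<theta> k *\<^sub>R z k) \<and>
       (\<forall>k i. i \<notin> Ss k \<longrightarrow> block_part blk i (z (Suc k)) = block_part blk i (z k)) \<and>
       (\<forall>k. \<forall>i\<in>Ss k.
          is_arg_min
            (\<lambda>t. ereal (block_part blk i (gradf (y k)) \<bullet> (t - block_part blk i (y k))
                    + n * \<theta> k * v i / (2 * \<tau>) * (block_norm B i (t - block_part blk i (z k)))\<^sup>2)
                 + \<psi> i t)
            (\<lambda>t. t \<in> block_space blk i)
            (block_part blk i (z (Suc k)))) \<and>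
       (\<forall>k. x (Suc k) = y k + (n / \<tau> * \<theta> k) *\<^sub>R (z (Suc k) - z k)))"

end

theory Submission
  imports Defs
begin

text \<open>
  The iterates depend only on the list of sampled block sets, since the block subproblems are
  strongly convex and so have at most one minimizer.  One step is therefore analysed with the
  past history fixed.  Let \<open>w\<close> be the point obtained from \<open>z\<close> by updating all blocks.
  The three-point inequality for \<open>w\<close>, the expected separable overapproximation of \<open>f\<close>
  and convexity of \<open>f\<close> give, with \<open>r\<^sub>k = \<parallel>z\<^sub>k - x\<^sub>*\<parallel>\<^sub>v\<^sup>2\<close>,
  \<open>\<bbbE> \<Delta>\<^sub>k\<^sub>+\<^sub>1 + n\<^sup>2\<theta>\<^sub>k\<^sup>2/(2\<tau>\<^sup>2) \<bbbE> r\<^sub>k\<^sub>+\<^sub>1 \<le> (1 - \<theta>\<^sub>k) \<Delta>\<^sub>k + n\<^sup>2\<theta>\<^sub>k\<^sup>2/(2\<tau>\<^sup>2) r\<^sub>k\<close>.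
  Here \<open>\<Delta>\<^sub>k\<close> is \<open>F(x\<^sub>k) - F(x\<^sub>*)\<close> with \<open>\<psi>(x\<^sub>k)\<close> replaced by the upper bound obtained from
  Jensen's inequality by writing \<open>x\<^sub>k\<close> as a convex combination of \<open>z\<^sub>0, \<dots>, z\<^sub>k\<close>; unlike
  \<open>\<psi>(x\<^sub>k)\<close> itself this bound has a computable conditional expectation.  After division by
  \<open>\<theta>\<^sub>k\<^sup>2\<close> the inequality telescopes, and \<open>\<theta>\<^sub>k \<le> 2/(k + 2n/\<tau>)\<close>.
\<close>

section \<open>Gradient inequality, block projections and block norms\<close>

text \<open>Restriction of \<open>f\<close> to the line through \<open>u\<close> and
  \<open>w\<close> reduces this to the tangent inequality in one variable, the slope at
  \<open>t = 0\<close> being \<open>g \<bullet> (w - u)\<close>.\<close>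

lemma convex_on_above_gradient:
  fixes f :: "'a::real_inner \<Rightarrow> real"
  assumes "convex_on UNIV f" and "GDERIV f u :> g"
  shows "f u + g \<bullet> (w - u) \<le> f w"
proof -
  define \<phi> where "\<phi> t = f (u + t *\<^sub>R (w - u))" for t
  have conv: "convex_on UNIV \<phi>"
  proof (rule convex_onI)
    fix t a b :: real
    assume t: "0 < t" "t < 1"
    have "u + ((1 - t) *\<^sub>R a + t *\<^sub>R b) *\<^sub>R (w - u) =
        (1 - t) *\<^sub>R (u + a *\<^sub>R (w - u)) + t *\<^sub>R (u + b *\<^sub>R (w - u))"
      by (simp add: algebra_simps)
    then show "\<phi> ((1 - t) *\<^sub>R a + t *\<^sub>R b) \<le> (1 - t) * \<phi> a + t * \<phi> b"
      using convex_onD[OF assms(1), of t "u + a *\<^sub>R (w - u)" "u + b *\<^sub>R (w - u)"] t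
      by (simp add: \<phi>_def)
  qed simp
  have "(f has_derivative (\<lambda>h. g \<bullet> h)) (at (u + 0 *\<^sub>R (w - u)))"
    using assms(2) by (simp add: gderiv_def inner_commute)
  then have "((\<lambda>t. f (u + t *\<^sub>R (w - u))) has_derivative (\<lambda>t. g \<bullet> (t *\<^sub>R (w - u)))) (at 0)"
    by (rule has_derivative_compose[rotated, where f = "\<lambda>t. u + t *\<^sub>R (w - u)"])
      (auto intro!: derivative_eq_intros)
  then have "(\<phi> has_field_derivative g \<bullet> (w - u)) (at 0)"
    by (simp add: has_field_derivative_def \<phi>_def[abs_def] mult_commute_abs)
  then have "\<phi> 1 - \<phi> 0 \<ge> (g \<bullet> (w - u)) * (1 - 0)"
    by (intro convex_on_imp_above_tangent[OF conv]) auto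
  then show ?thesis by (simp add: \<phi>_def)
qed

lemma block_part_linear: "linear (block_part blk i)"
  by (rule linearI) (auto simp: block_part_def vec_eq_iff)

lemmas block_part_simps =
  linear_add[OF block_part_linear] linear_diff[OF block_part_linear]
  linear_sum[OF block_part_linear] linear_scale[OF block_part_linear]

lemma block_part_in_space [simp]: "block_part blk i x \<in> block_space blk i"
  by (simp add: block_part_def block_space_def)

lemma block_part_block_part:
  "block_part blk i (block_part blk j x) = (if i = j then block_part blk i x else 0)"
  by (auto simp: block_part_def vec_eq_iff)

lemma block_part_id: "t \<in> block_space blk i \<Longrightarrow> block_part blk i t = t"
  by (auto simp: block_part_def block_space_def vec_eq_iff)

lemma sum_block_part: "(\<Sum>i\<in>UNIV. block_part blk i x) = x"
  for blk :: "'m::finite \<Rightarrow> 'b::finite"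
  by (auto simp: block_part_def vec_eq_iff)

lemma block_part_eqI: "(\<And>i. block_part blk i x = block_part blk i y) \<Longrightarrow> x = y"
  for blk :: "'m::finite \<Rightarrow> 'b::finite"
  by (metis (no_types, lifting) sum.cong sum_block_part)

lemma inner_block_part: "block_part blk i x \<bullet> block_part blk i y = block_part blk i x \<bullet> y"
  by (auto simp: block_part_def inner_vec_def intro!: sum.cong)

lemma sum_inner_block_part: "(\<Sum>i\<in>UNIV. block_part blk i x \<bullet> block_part blk i y) = x \<bullet> y"
  for blk :: "'m::finite \<Rightarrow> 'b::finite"
  by (simp add: inner_block_part flip: inner_sum_left) (simp add: sum_block_part)

lemma block_part_sum_part:
  fixes blk :: "'m::finite \<Rightarrow> 'b::finite"
  shows "block_part blk i (\<Sum>j\<in>T. block_part blk j (g j)) =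
    (if i \<in> T then block_part blk i (g i) else 0)"
  by (simp add: block_part_simps block_part_block_part)

text \<open>This expresses a random partial update through a full update \<open>w\<close> that is
  chosen before the sampled set \<open>T\<close>.\<close>

lemma block_part_mix:
  fixes blk :: "'m::finite \<Rightarrow> 'b::finite"
  shows "block_part blk i (z + block_restrict blk T (w - z)) =
    (if i \<in> T then block_part blk i w else block_part blk i z)"
  using block_part_sum_part[where blk = blk and i = i and T = T and g = "\<lambda>_. w - z"]
  by (simp add: block_restrict_def block_part_simps)

lemma subspace_block_space: "subspace (block_space blk i)"
  by (auto simp: subspace_def block_space_def)

lemma block_norm_sq:
  assumes "block_spd blk i (B i)" "t \<in> block_space blk i"
  shows "(block_norm B i t)\<^sup>2 = (B i *v t) \<bullet> t"
proof -
  have "(B i *v t) \<bullet> t \<ge> 0"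
    using assms by (cases "t = 0") (auto simp: block_spd_def less_imp_le)
  then show ?thesis by (simp add: block_norm_def)
qed

lemma block_norm_sq_pos:
  assumes "block_spd blk i (B i)" "t \<in> block_space blk i" "t \<noteq> 0"
  shows "(block_norm B i t)\<^sup>2 > 0"
  using assms block_norm_sq[where B = B, OF assms(1,2)] by (auto simp: block_spd_def)

text \<open>An identity of quadratic forms, that is, strong convexity with its exact modulus. It is
  the only property of the norm on which \<open>prox_three_point\<close> relies.\<close>

lemma block_norm_sq_comb:
  assumes "block_spd blk i (B i)" "a \<in> block_space blk i" "b \<in> block_space blk i"
  shows "(block_norm B i ((1 - t) *\<^sub>R a + t *\<^sub>R b))\<^sup>2 =
    (1 - t) * (block_norm B i a)\<^sup>2 + t * (block_norm B i b)\<^sup>2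
      - t * (1 - t) * (block_norm B i (b - a))\<^sup>2"
proof -
  note sub = subspace_block_space[of blk i]
  have "(1 - t) *\<^sub>R a + t *\<^sub>R b \<in> block_space blk i" "b - a \<in> block_space blk i"
    using assms(2,3) sub by (auto intro: subspace_add subspace_scale subspace_diff)
  then show ?thesis
    using assms
    by (simp add: block_norm_sq[of blk] matrix_vector_right_distrib matrix_vector_mult_diff_distrib
        matrix_vector_mult_scaleR inner_simps algebra_simps)
qed

lemma block_norm_scaleR: "(block_norm B i (c *\<^sub>R t))\<^sup>2 = c\<^sup>2 * (block_norm B i t)\<^sup>2"
proof -
  have "(B i *v (c *\<^sub>R t)) \<bullet> (c *\<^sub>R t) = c\<^sup>2 * ((B i *v t) \<bullet> t)"
    by (simp add: matrix_vector_mult_scaleR power2_eq_square)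
  then show ?thesis
    by (simp add: block_norm_def real_sqrt_mult power_mult_distrib)
qed

lemma norm_v_sq_scaleR: "norm_v_sq blk B v (c *\<^sub>R x) = c\<^sup>2 * norm_v_sq blk B v x"
  by (simp add: norm_v_sq_def block_part_simps block_norm_scaleR sum_distrib_left mult.left_commute)

lemma norm_v_sq_nonneg: "(\<And>i. v i > 0) \<Longrightarrow> norm_v_sq blk B v x \<ge> 0"
  unfolding norm_v_sq_def by (intro sum_nonneg mult_nonneg_nonneg) (auto intro: less_imp_le)

section \<open>Proximal inequality\<close>

text \<open>The minimality of \<open>u\<close> is tested against the points of the segment from \<open>u\<close> to \<open>w\<close>
  that tend to \<open>u\<close>.\<close>

lemma prox_three_point:
  fixes \<phi> :: "'a::real_inner \<Rightarrow> ereal" and q :: "'a \<Rightarrow> real"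
  assumes V: "subspace V" and conv: "ereal_convex_on V \<phi>"
    and q: "\<And>a b t. a \<in> V \<Longrightarrow> b \<in> V \<Longrightarrow>
      q ((1 - t) *\<^sub>R a + t *\<^sub>R b) = (1 - t) * q a + t * q b - t * (1 - t) * q (b - a)"
    and min: "is_arg_min (\<lambda>t. ereal (g \<bullet> (t - y) + c * q (t - z)) + \<phi> t) (\<lambda>t. t \<in> V) u"
    and z: "z \<in> V" and w: "w \<in> V" "\<phi> w < \<infinity>"
  shows "\<phi> u < \<infinity>"
    and "real_of_ereal (\<phi> u) + g \<bullet> (u - y) + c * q (u - z) + c * q (w - u)
      \<le> real_of_ereal (\<phi> w) + g \<bullet> (w - y) + c * q (w - z)"
proof -
  let ?l = "\<lambda>t. g \<bullet> (t - y) + c * q (t - z)"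
  have u: "u \<in> V" and le: "\<And>t. t \<in> V \<Longrightarrow> ereal (?l u) + \<phi> u \<le> ereal (?l t) + \<phi> t"
    using min by (auto simp: is_arg_min_def not_less)
  have fin: "\<phi> t \<noteq> -\<infinity>" if "t \<in> V" for t
    using conv that by (auto simp: ereal_convex_on_def)
  show fu: "\<phi> u < \<infinity>"
    using le[OF w(1)] w(2) by (cases "\<phi> u"; cases "\<phi> w") auto
  obtain a b where ab: "\<phi> u = ereal a" "\<phi> w = ereal b"
    using fu w fin[OF u] fin[OF w(1)] by (cases "\<phi> u"; cases "\<phi> w") auto
  have step: "a + ?l u + (1 - t) * (c * q (w - u)) \<le> b + ?l w" if t: "0 < t" "t < 1" for t
  proof -
    let ?p = "(1 - t) *\<^sub>R u + t *\<^sub>R w"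
    have p: "?p \<in> V" using V u w by (auto intro: subspace_add subspace_scale)
    have "\<phi> ?p \<le> ereal (1 - t) * \<phi> u + ereal t * \<phi> w"
      using conv u w t unfolding ereal_convex_on_def by blast
    then have "\<phi> ?p \<le> ereal ((1 - t) * a + t * b)" by (simp add: ab)
    then have "ereal (?l ?p) + \<phi> ?p \<le> ereal (?l ?p) + ereal ((1 - t) * a + t * b)"
      by (rule add_left_mono)
    with le[OF p] have "ereal (?l u) + \<phi> u \<le> ereal (?l ?p) + ereal ((1 - t) * a + t * b)"
      by (rule order_trans)
    then have *: "?l u + a \<le> ?l ?p + (1 - t) * a + t * b" by (simp add: ab)
    have pz: "?p - z = (1 - t) *\<^sub>R (u - z) + t *\<^sub>R (w - z)" by (simp add: algebra_simps)
    have qe: "q (?p - z) = (1 - t) * q (u - z) + t * q (w - z) - t * (1 - t) * q (w - u)"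
      unfolding pz using q[of "u - z" "w - z" t] V u w z by (simp add: subspace_diff)
    have ge: "g \<bullet> (?p - y) = (1 - t) * (g \<bullet> (u - y)) + t * (g \<bullet> (w - y))"
      by (simp add: inner_simps algebra_simps)
    \<comment> \<open>After the two expansions every remaining term carries a factor
      \<open>t\<close>. Cancelling it leaves \<open>1 - t\<close> in front of the quadratic gain,
      and this factor tends to 1.\<close>
    have "t * (a + ?l u + (1 - t) * (c * q (w - u))) \<le> t * (b + ?l w)"
      using *[unfolded qe ge] by (simp only: ring_distribs) (simp add: algebra_simps)
    then show ?thesis using t by simp
  qed
  have "((\<lambda>t. a + ?l u + (1 - t) * (c * q (w - u))) \<longlongrightarrow>
      a + ?l u + (1 - 0) * (c * q (w - u))) (at_right 0)"
    by (intro tendsto_intros)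
  moreover have "\<forall>\<^sub>F t in at_right 0. a + ?l u + (1 - t) * (c * q (w - u)) \<le> b + ?l w"
    unfolding eventually_at_right_field using step by (intro exI[of _ 1]) auto
  ultimately have "a + ?l u + (1 - 0) * (c * q (w - u)) \<le> b + ?l w"
    by (intro tendsto_upperbound) auto
  then show "real_of_ereal (\<phi> u) + g \<bullet> (u - y) + c * q (u - z) + c * q (w - u)
      \<le> real_of_ereal (\<phi> w) + g \<bullet> (w - y) + c * q (w - z)"
    by (simp add: ab algebra_simps)
qed

section \<open>The sequence of step parameters\<close>

text \<open>The update is the quadratic formula for the positive root of
  \<open>b\<^sup>2 + a\<^sup>2 * b = a\<^sup>2\<close>.\<close>

lemma approx_theta_step:
  assumes "0 < a"
  defines "b \<equiv> (sqrt (a ^ 4 + 4 * a\<^sup>2) - a\<^sup>2) / 2"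
  shows "0 < b" "b\<^sup>2 = (1 - b) * a\<^sup>2"
proof -
  have "sqrt (a ^ 4 + 4 * a\<^sup>2) > sqrt (a ^ 4)"
    using assms(1) by (intro real_sqrt_less_mono) simp
  moreover have "sqrt (a ^ 4) = a\<^sup>2"
    by (rule real_sqrt_unique) (simp_all flip: power_mult)
  ultimately show "0 < b" by (simp add: b_def)
  have "2 * b + a\<^sup>2 = sqrt (a ^ 4 + 4 * a\<^sup>2)"
    by (simp add: b_def field_simps)
  then have "(2 * b + a\<^sup>2)\<^sup>2 = a ^ 4 + 4 * a\<^sup>2"
    by simp
  moreover have "(2 * b + a\<^sup>2)\<^sup>2 = 4 * b\<^sup>2 + 4 * (b * a\<^sup>2) + a ^ 4"
    by (simp add: power2_eq_square algebra_simps power4_eq_xxxx)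
  ultimately show "b\<^sup>2 = (1 - b) * a\<^sup>2"
    by (simp add: algebra_simps)
qed

lemma approx_theta_pos: "0 < t0 \<Longrightarrow> 0 < approx_theta t0 k"
  by (induction k) (simp_all only: approx_theta.simps approx_theta_step(1))

lemma approx_theta_Suc_sq:
  "0 < t0 \<Longrightarrow> (approx_theta t0 (Suc k))\<^sup>2 = (1 - approx_theta t0 (Suc k)) * (approx_theta t0 k)\<^sup>2"
  using approx_theta_step(2)[OF approx_theta_pos, of t0 k] by (simp only: approx_theta.simps)

text \<open>With \<open>s = 1 / \<theta>\<close> the recursion reads \<open>(s' - 1/2)\<^sup>2 = s\<^sup>2 + 1/4\<close>, so \<open>s\<close> grows by
  at least \<open>1/2\<close> in each step.\<close>

lemma inverse_approx_theta_Suc: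
  assumes "0 < t0"
  shows "1 / approx_theta t0 k + 1 / 2 \<le> 1 / approx_theta t0 (Suc k)"
proof -
  define a b where "a = approx_theta t0 k" and "b = approx_theta t0 (Suc k)"
  have pos: "a > 0" "b > 0" and eq: "b\<^sup>2 = (1 - b) * a\<^sup>2"
    unfolding a_def b_def using approx_theta_pos[OF assms] approx_theta_Suc_sq[OF assms] by blast+
  have lt: "b < 1" using eq pos
    by (smt (verit) mult_nonneg_nonneg mult_nonpos_nonneg zero_less_power)
  have "(1 / a)\<^sup>2 = (1 / b)\<^sup>2 - 1 / b"
    using eq pos by (simp add: field_simps power2_eq_square)
  then have "(1 / b - 1 / 2)\<^sup>2 = (1 / a)\<^sup>2 + 1 / 4"
    by (simp add: power2_eq_square algebra_simps)
  then have "(1 / a)\<^sup>2 \<le> (1 / b - 1 / 2)\<^sup>2" by simp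
  moreover have "1 / b - 1 / 2 \<ge> 0" using lt pos by (simp add: field_simps)
  ultimately have "1 / a \<le> 1 / b - 1 / 2" by (rule power2_le_imp_le)
  then show ?thesis by (simp add: a_def b_def)
qed

text \<open>The increments of at least \<open>1/2\<close> from
  \<open>inverse_approx_theta_Suc\<close> are summed and the result is inverted. For
  \<open>t0 = \<tau> / n\<close> the bound reads \<open>2\<tau> / (k\<tau> + 2n)\<close>.\<close>

lemma approx_theta_le:
  assumes "0 < t0"
  shows "approx_theta t0 k \<le> 2 / (real k + 2 / t0)"
proof -
  have "1 / t0 + real k / 2 \<le> 1 / approx_theta t0 k"
  proof (induction k)
    case (Suc k)
    then show ?case using inverse_approx_theta_Suc[OF assms, of k] by (simp add: field_simps)
  qed simp
  then have "(real k + 2 / t0) * approx_theta t0 k \<le> 2"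
    using approx_theta_pos[OF assms, of k] by (simp add: field_simps)
  moreover have "real k + 2 / t0 > 0" using assms by (simp add: add_nonneg_pos)
  ultimately show ?thesis by (simp add: field_simps)
qed

lemma approx_theta_Suc_le:
  assumes "0 < t0"
  shows "approx_theta t0 (Suc k) \<le> approx_theta t0 k"
proof -
  have "1 / approx_theta t0 k \<le> 1 / approx_theta t0 (Suc k)"
    using inverse_approx_theta_Suc[OF assms, of k] by linarith
  then show ?thesis
    using approx_theta_pos[OF assms, of k] approx_theta_pos[OF assms, of "Suc k"]
    by (simp add: field_simps del: approx_theta.simps)
qed

lemma approx_theta_le_init:
  assumes "0 < t0"
  shows "approx_theta t0 k \<le> t0"
  by (induction k) (use approx_theta_Suc_le[OF assms] in \<open>auto intro: order_trans simp del: approx_theta.simps(2)\<close>)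

section \<open>Independent samples and the law of histories\<close>

text \<open>The tower property, conditioning on the tail \<open>h\<close>. Since
  \<open>replicate_pmf\<close> draws the head first, the two draws are commuted so that the head
  becomes the latest sample.\<close>

lemma expectation_replicate_pmf_Suc:
  fixes g :: "'a list \<Rightarrow> real"
  assumes "finite (set_pmf p)"
  shows "measure_pmf.expectation (replicate_pmf (Suc k) p) g =
    measure_pmf.expectation (replicate_pmf k p) (\<lambda>h. measure_pmf.expectation p (\<lambda>T. g (T # h)))"
proof -
  have fin: "finite (set_pmf (replicate_pmf k p))"
    using finite_lists_length_eq[OF assms, of k] by (simp add: set_replicate_pmf lists_eq_set conj_commute)
  have "replicate_pmf (Suc k) p = replicate_pmf k p \<bind> (\<lambda>h. map_pmf (\<lambda>T. T # h) p)"
    by (subst replicate_pmf.simps, subst bind_commute_pmf) (simp add: map_pmf_def)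
  then have "measure_pmf.expectation (replicate_pmf (Suc k) p) g =
      (\<Sum>h\<in>set_pmf (replicate_pmf k p). pmf (replicate_pmf k p) h *\<^sub>R
        measure_pmf.expectation (map_pmf (\<lambda>T. T # h) p) g)"
    using fin assms by (simp only:) (rule pmf_expectation_bind, auto)
  also have "\<dots> = measure_pmf.expectation (replicate_pmf k p)
      (\<lambda>h. measure_pmf.expectation p (\<lambda>T. g (T # h)))"
    using fin by (subst integral_measure_pmf[OF fin]) (auto simp: set_pmf_iff)
  finally show ?thesis .
qed

text \<open>Lists over a countable type are countable, so both laws are compared on singletons.
  There each gives the product of the point masses: on one side by independence, on the other by
  induction. The reversal puts the newest sample at the head.\<close>

lemma (in prob_space) distr_iid_list:
  fixes S :: "nat \<Rightarrow> 'a \<Rightarrow> 'c::countable"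
  assumes indep: "indep_vars (\<lambda>_. count_space UNIV) S UNIV"
    and distr: "\<And>k. distr M (count_space UNIV) (S k) = measure_pmf p"
  shows "(\<lambda>\<omega>. map (\<lambda>i. S i \<omega>) (rev [0..<k])) \<in> M \<rightarrow>\<^sub>M count_space UNIV"
    and "distr M (count_space UNIV) (\<lambda>\<omega>. map (\<lambda>i. S i \<omega>) (rev [0..<k])) = replicate_pmf k p"
proof -
  define H where "H k \<omega> = map (\<lambda>i. S i \<omega>) (rev [0..<k])" for k \<omega>
  have H_Suc: "H (Suc k) \<omega> = S k \<omega> # H k \<omega>" for k \<omega> by (simp add: H_def)
  have S_meas: "S k \<in> M \<rightarrow>\<^sub>M count_space UNIV" for k
    using indep by (simp add: indep_vars_def)
  have S_prob: "prob (S k -` {T} \<inter> space M) = pmf p T" for k T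
    using measure_distr[OF S_meas, of "{T}" k] distr by (simp add: pmf.rep_eq)
  \<comment> \<open>\<open>rev h ! i\<close> is the sample of iteration \<open>i\<close>, as the
    newest comes first. The outer intersection with \<open>space M\<close> matters at
    \<open>k = 0\<close>, where the empty intersection is the whole type.\<close>
  have H_fibre: "H k -` {h} \<inter> space M =
      (if length h = k then (\<Inter>i<k. S i -` {rev h ! i} \<inter> space M) \<inter> space M else {})" for k h
  proof (induction k arbitrary: h)
    case 0
    then show ?case by (auto simp: H_def)
  next
    case (Suc k)
    show ?case
    proof (cases h)
      case (Cons T h')
      have "H (Suc k) -` {h} \<inter> space M = (S k -` {T} \<inter> space M) \<inter> (H k -` {h'} \<inter> space M)"
        by (auto simp: H_Suc Cons)
      then show ?thesis
        by (auto simp: Suc.IH Cons nth_append lessThan_Suc)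
    qed (auto simp: H_Suc)
  qed
  have sets: "H k -` {h} \<inter> space M \<in> events" for k h
  proof (cases "k = 0")
    case False
    then have "(\<Inter>i<k. S i -` {rev h ! i} \<inter> space M) \<in> events"
      by (intro sets.finite_INT measurable_sets[OF S_meas]) auto
    then show ?thesis unfolding H_fibre by (auto intro: sets.Int)
  qed (simp add: H_fibre)
  have H_meas: "H k \<in> M \<rightarrow>\<^sub>M count_space UNIV" for k
    by (subst measurable_count_space_eq2_countable) (auto simp: sets)
  have prob_INT: "prob ((\<Inter>i<k. S i -` {a i} \<inter> space M) \<inter> space M) = (\<Prod>i<k. pmf p (a i))" for k a
  proof (cases "k = 0")
    case True
    then show ?thesis by (simp add: prob_space)
  next
    case False
    then have "prob (\<Inter>i<k. S i -` {a i} \<inter> space M) = (\<Prod>i<k. prob (S i -` {a i} \<inter> space M))"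
      by (intro indep_varsD[OF indep]) auto
    moreover have "(\<Inter>i<k. S i -` {a i} \<inter> space M) \<inter> space M = (\<Inter>i<k. S i -` {a i} \<inter> space M)"
      using False by auto
    ultimately show ?thesis by (simp add: S_prob)
  qed
  have pmf: "pmf (replicate_pmf k p) h = (if length h = k then \<Prod>i<k. pmf p (rev h ! i) else 0)" for k h
  proof (induction k arbitrary: h)
    case (Suc k)
    have rep: "replicate_pmf (Suc k) p = map_pmf (\<lambda>(T, h). T # h) (pair_pmf p (replicate_pmf k p))"
      by (simp add: pair_pmf_def map_pmf_def bind_assoc_pmf bind_return_pmf)
    show ?case
    proof (cases h)
      case Nil
      then show ?thesis by (auto simp: set_replicate_pmf pmf_eq_0_set_pmf simp del: replicate_pmf.simps)
    next
      case (Cons T h')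
      have "inj (\<lambda>(T :: 'c, h). T # h)" by (auto simp: inj_def)
      from pmf_map_inj'[OF this, of "pair_pmf p (replicate_pmf k p)" "(T, h')"]
      have "pmf (replicate_pmf (Suc k) p) h = pmf p T * pmf (replicate_pmf k p) h'"
        by (simp add: rep Cons pmf_pair del: replicate_pmf.simps)
      also have "\<dots> = (if length h = Suc k then \<Prod>i<Suc k. pmf p (rev h ! i) else 0)"
        by (auto simp: Suc.IH Cons nth_append intro!: prod.cong)
      finally show ?thesis .
    qed
  qed (simp add: indicator_def)
  show "(\<lambda>\<omega>. map (\<lambda>i. S i \<omega>) (rev [0..<k])) \<in> M \<rightarrow>\<^sub>M count_space UNIV"
    using H_meas[of k] by (simp add: H_def[abs_def])
  have "distr M (count_space UNIV) (H k) = replicate_pmf k p"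
  proof (rule measure_eqI_countable)
    fix h :: "'c list"
    have "emeasure (distr M (count_space UNIV) (H k)) {h} = prob (H k -` {h} \<inter> space M)"
      by (simp add: emeasure_distr H_meas emeasure_eq_measure)
    also have "\<dots> = ennreal (pmf (replicate_pmf k p) h)"
      unfolding H_fibre pmf using prob_INT[of "\<lambda>i. rev h ! i" k] by auto
    finally show "emeasure (distr M (count_space UNIV) (H k)) {h} = emeasure (replicate_pmf k p) {h}"
      by (simp add: emeasure_pmf_single)
  qed (auto simp: H_def)
  then show "distr M (count_space UNIV) (\<lambda>\<omega>. map (\<lambda>i. S i \<omega>) (rev [0..<k])) = replicate_pmf k p"
    by (simp add: H_def[abs_def])
qed

section \<open>Convex combinations and averages over a sampling\<close>

text \<open>Jensen's inequality for two points with unnormalized weights. The form without division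
  also covers total weight 0, where any point of \<open>D\<close> serves as
  \<open>q\<close>.\<close>

lemma convex_on_merge:
  fixes p z :: "'a::real_vector"
  assumes "convex_on D P" "p \<in> D" "z \<in> D" "0 \<le> \<alpha>" "0 \<le> \<beta>"
  obtains q where "q \<in> D" "\<alpha> *\<^sub>R z + \<beta> *\<^sub>R p = (\<alpha> + \<beta>) *\<^sub>R q"
    "(\<alpha> + \<beta>) * P q \<le> \<alpha> * P z + \<beta> * P p"
proof (cases "\<alpha> + \<beta> = 0")
  case True
  then have "\<alpha> = 0" "\<beta> = 0" using assms(4,5) by linarith+
  then show ?thesis using that[of z] assms(3) by simp
next
  case False
  define t where "t = \<beta> / (\<alpha> + \<beta>)"
  have pos: "\<alpha> + \<beta> > 0" using False assms(4,5) by linarith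
  have t: "0 \<le> t" "t \<le> 1" "(\<alpha> + \<beta>) * t = \<beta>" "(\<alpha> + \<beta>) * (1 - t) = \<alpha>"
    using assms(4,5) pos by (auto simp: t_def field_simps)
  let ?q = "(1 - t) *\<^sub>R z + t *\<^sub>R p"
  have "?q \<in> D" using assms(1-3) t by (auto intro!: convexD dest: convex_on_imp_convex)
  moreover have "(\<alpha> + \<beta>) *\<^sub>R ?q = \<alpha> *\<^sub>R z + \<beta> *\<^sub>R p"
    by (simp only: scaleR_right_distrib scaleR_scaleR t)
  moreover have "(\<alpha> + \<beta>) * P ?q \<le> (\<alpha> + \<beta>) * ((1 - t) * P z + t * P p)"
    using convex_onD[OF assms(1) t(1,2) assms(3,2)] pos by (intro mult_left_mono) auto
  then have "(\<alpha> + \<beta>) * P ?q \<le> ((\<alpha> + \<beta>) * (1 - t)) * P z + ((\<alpha> + \<beta>) * t) * P p"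
    by (simp only: ring_distribs mult.assoc)
  ultimately show ?thesis using that t(3,4) by metis
qed

text \<open>By linearity only the marginals enter: block \<open>i\<close> comes from
  \<open>w\<close> with probability \<open>r\<close> and from \<open>z\<close> otherwise.\<close>

lemma expectation_block_mix:
  fixes blk :: "'m::finite \<Rightarrow> 'b::finite" and g :: "'b \<Rightarrow> real ^ 'm \<Rightarrow> real"
  assumes prob: "\<And>i. measure_pmf.prob p {T. i \<in> T} = r"
  shows "measure_pmf.expectation p
      (\<lambda>T. \<Sum>i\<in>UNIV. g i (block_part blk i (z + block_restrict blk T (w - z)))) =
    (1 - r) * (\<Sum>i\<in>UNIV. g i (block_part blk i z)) + r * (\<Sum>i\<in>UNIV. g i (block_part blk i w))"
proof -
  have int: "integrable (measure_pmf p) h" for h :: "'b set \<Rightarrow> real"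
    by (rule integrable_measure_pmf_finite) simp
  have "measure_pmf.expectation p
      (\<lambda>T. g i (block_part blk i (z + block_restrict blk T (w - z)))) =
      (1 - r) * g i (block_part blk i z) + r * g i (block_part blk i w)" for i
  proof -
    have "g i (block_part blk i (z + block_restrict blk T (w - z))) =
        g i (block_part blk i z) + indicator {T. i \<in> T} T *
          (g i (block_part blk i w) - g i (block_part blk i z))" for T
      by (simp add: block_part_mix)
    then show ?thesis
      by (simp only: int prob Bochner_Integration.integral_add Bochner_Integration.integral_mult_left)
        (simp add: prob algebra_simps)
  qed
  then show ?thesis
    by (simp add: Bochner_Integration.integral_sum int sum.distrib flip: sum_distrib_left)
qed

text \<open>The cardinality is a sum of membership indicators, so the expected size is a sum of
  equal marginals.\<close>

lemma uniform_sampling_prob: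
  fixes p :: "'b::finite set pmf"
  assumes "uniform_sampling p"
  shows "measure_pmf.prob p {T. i \<in> T} =
    measure_pmf.expectation p (\<lambda>T. real (card T)) / real CARD('b)"
proof -
  have int: "integrable (measure_pmf p) h" for h :: "'b set \<Rightarrow> real"
    by (rule integrable_measure_pmf_finite) simp
  have "real (card T) = (\<Sum>j\<in>UNIV. indicator {T. j \<in> T} T)" for T :: "'b set"
    by (simp add: indicator_def sum.If_cases)
  then have "measure_pmf.expectation p (\<lambda>T. real (card T)) =
      (\<Sum>j\<in>UNIV. measure_pmf.prob p {T. j \<in> T})"
    by (simp add: Bochner_Integration.integral_sum int)
  also have "\<dots> = (\<Sum>j\<in>(UNIV :: 'b set). measure_pmf.prob p {T. i \<in> T})"
    using assms by (intro sum.cong) (auto simp: uniform_sampling_def)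
  finally show ?thesis by simp
qed

section \<open>The composite problem and its effective domain\<close>

text \<open>The iterates and the probability space that carries them stay outside the locale; the
  analysis runs on finite histories of sampled sets.\<close>

locale approx_setup =
  fixes blk :: "'m::finite \<Rightarrow> 'b::finite"
    and B :: "'b \<Rightarrow> real ^ 'm ^ 'm"
    and v :: "'b \<Rightarrow> real"
    and f :: "real ^ 'm \<Rightarrow> real"
    and gradf :: "real ^ 'm \<Rightarrow> real ^ 'm"
    and \<psi> :: "'b \<Rightarrow> real ^ 'm \<Rightarrow> ereal"
    and Shat :: "'b set pmf"
    and x0 xs :: "real ^ 'm"
    and n \<tau> :: real
  assumes n_def: "n = real CARD('b)"
    and B: "\<And>i. block_spd blk i (B i)"
    and f_convex: "convex_on UNIV f"
    and f_grad: "\<And>u. GDERIV f u :> gradf u"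
    and uniform: "uniform_sampling Shat"
    and tau: "\<tau> = measure_pmf.expectation Shat (\<lambda>T. real (card T))"
    and tau_pos: "\<tau> > 0"
    and v_pos: "\<And>i. v i > 0"
    and ESO: "\<And>u h. measure_pmf.expectation Shat (\<lambda>T. f (u + block_restrict blk T h))
                \<le> f u + \<tau> / n * (gradf u \<bullet> h + 1 / 2 * norm_v_sq blk B v h)"
    and psi_convex: "\<And>i. ereal_convex_on (block_space blk i) (\<psi> i)"
    and x0_dom: "block_sum blk \<psi> x0 < \<infinity>"
    and xs_min: "\<And>u. objective f blk \<psi> xs \<le> objective f blk \<psi> u"
begin

abbreviation bp :: "'b \<Rightarrow> real ^ 'm \<Rightarrow> real ^ 'm" where "bp \<equiv> block_part blk"
abbreviation N :: "real ^ 'm \<Rightarrow> real" where "N \<equiv> norm_v_sq blk B v"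
abbreviation \<theta> :: "nat \<Rightarrow> real" where "\<theta> \<equiv> approx_theta (\<tau> / n)"

definition feasible :: "(real ^ 'm) set" where
  "feasible = {u. block_sum blk \<psi> u < \<infinity>}"

text \<open>The real-valued version of the separable term, meaningful on \<open>feasible\<close>;
  elsewhere \<open>real_of_ereal\<close> returns the default 0.\<close>

definition P :: "real ^ 'm \<Rightarrow> real" where
  "P u = real_of_ereal (block_sum blk \<psi> u)"

lemma n_pos: "n > 0"
  by (simp add: n_def)

lemma prob_mem: "measure_pmf.prob Shat {T. i \<in> T} = \<tau> / n"
  using uniform_sampling_prob[OF uniform] by (simp add: tau n_def)

lemma theta_init: "0 < \<tau> / n" "\<tau> / n \<le> 1"
proof -
  show "0 < \<tau> / n" using tau_pos n_pos by simp
  show "\<tau> / n \<le> 1" using prob_mem measure_pmf.prob_le_1 by metis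
qed

lemma theta_pos: "\<theta> k > 0"
  using approx_theta_pos theta_init by blast

lemma theta_le_init: "\<theta> k \<le> \<tau> / n"
  using approx_theta_le_init theta_init by blast

lemma theta_le_1: "\<theta> k \<le> 1"
  using theta_le_init[of k] theta_init by linarith

lemma psi_not_MInf: "\<psi> i (bp i u) \<noteq> -\<infinity>"
  using psi_convex[of i] by (auto simp: ereal_convex_on_def)

lemma feasible_iff: "u \<in> feasible \<longleftrightarrow> (\<forall>i. \<psi> i (bp i u) < \<infinity>)"
  by (auto simp: feasible_def block_sum_def sum_Pinfty less_top)

lemma psi_eq_ereal: "u \<in> feasible \<Longrightarrow> \<psi> i (bp i u) = ereal (real_of_ereal (\<psi> i (bp i u)))"
  using psi_not_MInf[of i u] by (cases "\<psi> i (bp i u)") (auto simp: feasible_iff)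

lemma block_sum_eq:
  assumes "u \<in> feasible"
  shows "block_sum blk \<psi> u = ereal (P u)" "P u = (\<Sum>i\<in>UNIV. real_of_ereal (\<psi> i (bp i u)))"
proof -
  have *: "block_sum blk \<psi> u = ereal (\<Sum>i\<in>UNIV. real_of_ereal (\<psi> i (bp i u)))"
    unfolding block_sum_def sum_ereal[symmetric]
    by (intro sum.cong refl psi_eq_ereal[OF assms])
  then show "P u = (\<Sum>i\<in>UNIV. real_of_ereal (\<psi> i (bp i u)))" by (simp add: P_def)
  then show "block_sum blk \<psi> u = ereal (P u)" using * by simp
qed

lemma P_convex: "convex_on feasible P"
proof -
  have blockwise: "\<psi> i (bp i ((1 - t) *\<^sub>R u + t *\<^sub>R w)) \<le>
      ereal ((1 - t) * real_of_ereal (\<psi> i (bp i u)) + t * real_of_ereal (\<psi> i (bp i w)))"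
    if "0 < t" "t < 1" "u \<in> feasible" "w \<in> feasible" for i t u w
  proof -
    have "\<psi> i ((1 - t) *\<^sub>R bp i u + t *\<^sub>R bp i w) \<le>
        ereal (1 - t) * \<psi> i (bp i u) + ereal t * \<psi> i (bp i w)"
      using psi_convex[of i] that by (simp add: ereal_convex_on_def)
    then show ?thesis
      by (subst (asm) psi_eq_ereal[OF that(3)], subst (asm) psi_eq_ereal[OF that(4)])
        (simp add: block_part_simps)
  qed
  have mem: "(1 - t) *\<^sub>R u + t *\<^sub>R w \<in> feasible"
    if "0 < t" "t < 1" "u \<in> feasible" "w \<in> feasible" for t u w
    unfolding feasible_iff
  proof
    fix i
    show "\<psi> i (bp i ((1 - t) *\<^sub>R u + t *\<^sub>R w)) < \<infinity>"
      using blockwise[OF that, of i] by (rule le_less_trans) simp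
  qed
  show ?thesis
  proof (rule convex_onI)
    fix t :: real and u w
    assume *: "0 < t" "t < 1" "u \<in> feasible" "w \<in> feasible"
    have "real_of_ereal (\<psi> i (bp i ((1 - t) *\<^sub>R u + t *\<^sub>R w))) \<le>
      (1 - t) * real_of_ereal (\<psi> i (bp i u)) + t * real_of_ereal (\<psi> i (bp i w))" for i
      using blockwise[OF *, of i] psi_eq_ereal[OF mem[OF *], of i] by (metis ereal_less_eq(3))
    then show "P ((1 - t) *\<^sub>R u + t *\<^sub>R w) \<le> (1 - t) * P u + t * P w"
      by (auto simp: block_sum_eq(2) * mem[OF *] sum_distrib_left simp flip: sum.distrib
          intro!: sum_mono)
  next
    show "convex feasible"
      unfolding convex_alt
    proof (intro ballI allI impI)
      fix u w t assume "u \<in> feasible" "w \<in> feasible" "0 \<le> t \<and> t \<le> (1::real)"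
      then show "(1 - t) *\<^sub>R u + t *\<^sub>R w \<in> feasible"
        using mem[of t u w] by (cases "t = 0"; cases "t = 1") auto
    qed
  qed
qed

lemma xs_feasible: "xs \<in> feasible"
proof -
  have "objective f blk \<psi> xs < \<infinity>"
    using xs_min[of x0] x0_dom by (auto simp: objective_def)
  then show ?thesis by (auto simp: objective_def feasible_def)
qed

lemma objective_eq: "u \<in> feasible \<Longrightarrow> objective f blk \<psi> u = ereal (f u + P u)"
  by (simp add: objective_def block_sum_eq)

section \<open>Block subproblems and the full proximal step\<close>

text \<open>The subproblem of \<open>approx_run\<close> at arbitrary points, so that it can also be
  posed for blocks outside the sampled set.\<close>

definition block_argmin :: "nat \<Rightarrow> (real ^ 'm) \<Rightarrow> (real ^ 'm) \<Rightarrow> 'b \<Rightarrow> real ^ 'm \<Rightarrow> bool" where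
  "block_argmin k y z i = is_arg_min
     (\<lambda>t. ereal (bp i (gradf y) \<bullet> (t - bp i y)
             + n * \<theta> k * v i / (2 * \<tau>) * (block_norm B i (t - bp i z))\<^sup>2) + \<psi> i t)
     (\<lambda>t. t \<in> block_space blk i)"

lemma block_argmin_three_point:
  assumes "block_argmin k y z i u" "t \<in> block_space blk i" "\<psi> i t < \<infinity>"
  shows "\<psi> i u < \<infinity>"
    and "real_of_ereal (\<psi> i u) + bp i (gradf y) \<bullet> (u - bp i y)
        + n * \<theta> k * v i / (2 * \<tau>) * (block_norm B i (u - bp i z))\<^sup>2
        + n * \<theta> k * v i / (2 * \<tau>) * (block_norm B i (t - u))\<^sup>2
      \<le> real_of_ereal (\<psi> i t) + bp i (gradf y) \<bullet> (t - bp i y)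
        + n * \<theta> k * v i / (2 * \<tau>) * (block_norm B i (t - bp i z))\<^sup>2"
proof -
  note three_point = prox_three_point[where q = "\<lambda>t. (block_norm B i t)\<^sup>2",
      OF subspace_block_space psi_convex block_norm_sq_comb[OF B]
        assms(1)[unfolded block_argmin_def] block_part_in_space assms(2,3)]
  show "\<psi> i u < \<infinity>" by (rule three_point(1))
  show "real_of_ereal (\<psi> i u) + bp i (gradf y) \<bullet> (u - bp i y)
        + n * \<theta> k * v i / (2 * \<tau>) * (block_norm B i (u - bp i z))\<^sup>2
        + n * \<theta> k * v i / (2 * \<tau>) * (block_norm B i (t - u))\<^sup>2
      \<le> real_of_ereal (\<psi> i t) + bp i (gradf y) \<bullet> (t - bp i y)
        + n * \<theta> k * v i / (2 * \<tau>) * (block_norm B i (t - bp i z))\<^sup>2"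
    by (rule three_point(2))
qed

text \<open>Adding the three-point inequality of \<open>u\<close> against \<open>w\<close> to that
  of \<open>w\<close> against \<open>u\<close> cancels everything but two positive quadratic
  terms.\<close>

lemma block_argmin_unique:
  assumes "block_argmin k y z i u" "block_argmin k y z i w"
  shows "u = w"
proof (rule ccontr)
  assume neq: "u \<noteq> w"
  have V: "u \<in> block_space blk i" "w \<in> block_space blk i"
    using assms by (auto simp: block_argmin_def is_arg_min_def)
  have "\<psi> i (bp i xs) < \<infinity>" using xs_feasible by (simp add: feasible_iff)
  then have fin: "\<psi> i u < \<infinity>" "\<psi> i w < \<infinity>"
    using block_argmin_three_point(1)[OF _ block_part_in_space] assms by blast+
  define c where "c = n * \<theta> k * v i / (2 * \<tau>)"
  have "c > 0" using n_pos theta_pos v_pos tau_pos by (simp add: c_def)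
  moreover have "w - u \<in> block_space blk i" "u - w \<in> block_space blk i"
    using V by (auto intro: subspace_diff[OF subspace_block_space])
  then have "(block_norm B i (w - u))\<^sup>2 > 0" "(block_norm B i (u - w))\<^sup>2 > 0"
    using block_norm_sq_pos[where B = B, OF B] neq by (metis right_minus_eq)+
  ultimately have "c * (block_norm B i (w - u))\<^sup>2 + c * (block_norm B i (u - w))\<^sup>2 > 0"
    by (simp add: add_pos_pos)
  then show False
    using block_argmin_three_point(2)[OF assms(1) V(2) fin(2)]
      block_argmin_three_point(2)[OF assms(2) V(1) fin(1)]
    unfolding c_def by linarith
qed

text \<open>The blocks of \<open>full_step\<close> without a minimizer are arbitrary.\<close>

definition full_step :: "nat \<Rightarrow> real ^ 'm \<Rightarrow> real ^ 'm \<Rightarrow> real ^ 'm" where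
  "full_step k y z = (\<Sum>i\<in>UNIV. bp i (SOME t. block_argmin k y z i t))"

text \<open>By uniqueness the choice operator returns the very minimizer that a run has
  used.\<close>

lemma block_part_full_step:
  assumes "block_argmin k y z i t"
  shows "bp i (full_step k y z) = t"
proof -
  have "(SOME t. block_argmin k y z i t) = t"
    using assms block_argmin_unique by blast
  moreover have "t \<in> block_space blk i"
    using assms by (simp add: block_argmin_def is_arg_min_def)
  ultimately show ?thesis
    by (simp add: full_step_def block_part_sum_part block_part_id)
qed

text \<open>All blocks are included, because the analysis compares with the full update although an
  iteration solves only the sampled subproblems.\<close>

definition solvable :: "nat \<Rightarrow> real ^ 'm \<Rightarrow> real ^ 'm \<Rightarrow> bool" where
  "solvable k y z \<longleftrightarrow> (\<forall>i. \<exists>t. block_argmin k y z i t)"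

lemma block_argmin_full_step:
  "solvable k y z \<Longrightarrow> block_argmin k y z i (bp i (full_step k y z))"
  unfolding solvable_def using block_part_full_step by metis

text \<open>The blockwise inequalities, tested at the blocks of \<open>xs\<close>, are added up;
  \<open>P\<close>, the inner product and \<open>N\<close> are all separable over the
  blocks.\<close>

lemma full_step_three_point:
  assumes "solvable k y z"
  defines "w \<equiv> full_step k y z"
  shows "w \<in> feasible"
    and "P w + gradf y \<bullet> (w - y) + n * \<theta> k / (2 * \<tau>) * N (w - z) + n * \<theta> k / (2 * \<tau>) * N (w - xs)
      \<le> P xs + gradf y \<bullet> (xs - y) + n * \<theta> k / (2 * \<tau>) * N (z - xs)"
proof -
  have xs: "\<psi> i (bp i xs) < \<infinity>" for i using xs_feasible by (simp add: feasible_iff)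
  note arg = block_argmin_full_step[OF assms(1), folded w_def]
  show w: "w \<in> feasible"
    unfolding feasible_iff using block_argmin_three_point(1)[OF arg block_part_in_space xs] by blast
  have sum_N: "(\<Sum>i\<in>UNIV. n * \<theta> k * v i / (2 * \<tau>) * (block_norm B i (bp i a - bp i b))\<^sup>2) =
      n * \<theta> k / (2 * \<tau>) * N (a - b)" for a b
    by (simp add: norm_v_sq_def block_part_simps sum_distrib_left mult.assoc)
  have sum_g: "(\<Sum>i\<in>UNIV. bp i (gradf y) \<bullet> (bp i a - bp i b)) = gradf y \<bullet> (a - b)" for a b
    using sum_inner_block_part[of blk "gradf y" "a - b"] by (simp add: block_part_simps)
  have N_sym: "N (a - b) = N (b - a)" for a b
    using norm_v_sq_scaleR[of blk B v "-1" "b - a"] by simp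
  have "(\<Sum>i\<in>UNIV. real_of_ereal (\<psi> i (bp i w)) + bp i (gradf y) \<bullet> (bp i w - bp i y)
        + n * \<theta> k * v i / (2 * \<tau>) * (block_norm B i (bp i w - bp i z))\<^sup>2
        + n * \<theta> k * v i / (2 * \<tau>) * (block_norm B i (bp i xs - bp i w))\<^sup>2)
      \<le> (\<Sum>i\<in>UNIV. real_of_ereal (\<psi> i (bp i xs)) + bp i (gradf y) \<bullet> (bp i xs - bp i y)
        + n * \<theta> k * v i / (2 * \<tau>) * (block_norm B i (bp i xs - bp i z))\<^sup>2)"
    by (intro sum_mono block_argmin_three_point(2)[OF arg block_part_in_space xs])
  then show "P w + gradf y \<bullet> (w - y) + n * \<theta> k / (2 * \<tau>) * N (w - z) + n * \<theta> k / (2 * \<tau>) * N (w - xs)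
      \<le> P xs + gradf y \<bullet> (xs - y) + n * \<theta> k / (2 * \<tau>) * N (z - xs)"
    by (simp only: sum.distrib sum_N sum_g block_sum_eq(2)[OF w] block_sum_eq(2)[OF xs_feasible]
        N_sym[of xs])
qed

section \<open>Iterates as functions of the sampled history\<close>

text \<open>In a history \<open>T # h\<close> the most recently sampled block set \<open>T\<close> comes first.\<close>

primrec state :: "'b set list \<Rightarrow> (real ^ 'm) \<times> (real ^ 'm)" where
  "state [] = (x0, x0)"
| "state (T # h) =
    (let k = length h; x = fst (state h); z = snd (state h);
         y = (1 - \<theta> k) *\<^sub>R x + \<theta> k *\<^sub>R z;
         z' = z + block_restrict blk T (full_step k y z - z)
     in (y + (n / \<tau> * \<theta> k) *\<^sub>R (z' - z), z'))"

definition "X h = fst (state h)"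
definition "Z h = snd (state h)"
definition "Y h = (1 - \<theta> (length h)) *\<^sub>R X h + \<theta> (length h) *\<^sub>R Z h"
definition "W h = full_step (length h) (Y h) (Z h)"

lemma state_Nil: "X [] = x0" "Z [] = x0"
  by (simp_all add: X_def Z_def)

lemma state_Cons:
  "Z (T # h) = Z h + block_restrict blk T (W h - Z h)"
  "X (T # h) = Y h + (n / \<tau> * \<theta> (length h)) *\<^sub>R (Z (T # h) - Z h)"
  by (simp_all add: X_def Z_def Y_def W_def Let_def)

definition solvable_at :: "'b set list \<Rightarrow> bool" where
  "solvable_at h \<longleftrightarrow> solvable (length h) (Y h) (Z h)"

primrec solvable_along :: "'b set list \<Rightarrow> bool" where
  "solvable_along [] = True"
| "solvable_along (T # h) = (solvable_along h \<and> solvable_at h)"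

text \<open>The coefficients are those of \<open>X h\<close>, \<open>Z h\<close> and
  \<open>Z (T # h)\<close> in \<open>X (T # h)\<close>. The middle one is at most 0 since
  \<open>\<tau> \<le> n\<close>, so convexity cannot be applied to a single step; the weight that
  \<open>Z h\<close> already has in \<open>X h\<close> compensates.\<close>

primrec psihat :: "'b set list \<Rightarrow> real" where
  "psihat [] = P x0"
| "psihat (T # h) = (1 - \<theta> (length h)) * psihat h
     + (\<theta> (length h) - n / \<tau> * \<theta> (length h)) * P (Z h)
     + n / \<tau> * \<theta> (length h) * P (Z (T # h))"

primrec wt :: "nat \<Rightarrow> real" where
  "wt 0 = 1"
| "wt (Suc k) = n / \<tau> * \<theta> k"

lemma wt_bounds: "0 \<le> wt k" "wt k \<le> 1"
proof -
  have "n / \<tau> * \<theta> j \<le> n / \<tau> * (\<tau> / n)" for j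
    using theta_le_init n_pos tau_pos by (intro mult_left_mono) auto
  then have "n / \<tau> * \<theta> j \<le> 1" for j using n_pos tau_pos by (simp add: field_simps)
  then show "wt k \<le> 1" by (cases k) auto
  show "0 \<le> wt k" using n_pos tau_pos theta_pos by (cases k) (auto intro: less_imp_le)
qed

text \<open>This is the total coefficient of \<open>Z h\<close> in \<open>X (T # h)\<close>: its
  share in \<open>X h\<close>, scaled by \<open>1 - \<theta> k\<close>, plus the direct term. It is
  nonnegative because \<open>\<theta>\<close> decreases and stays below
  \<open>\<tau> / n\<close>.\<close>

lemma wt_step: "(1 - \<theta> k) * wt k + \<theta> k - wt (Suc k) \<ge> 0"
proof (cases k)
  case 0
  then show ?thesis using n_pos tau_pos by simp
next
  case (Suc j)
  have "(1 - \<theta> k) * \<theta> j \<ge> (1 - \<theta> k) * \<theta> k"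
    unfolding Suc using theta_le_1 approx_theta_Suc_le[OF theta_init(1)]
    by (intro mult_left_mono) (simp_all del: approx_theta.simps)
  moreover have "(1 - \<theta> k) * \<theta> k \<ge> (1 - \<tau> / n) * \<theta> k"
    using theta_le_init theta_pos by (intro mult_right_mono) (auto intro: less_imp_le)
  ultimately have "n / \<tau> * ((1 - \<tau> / n) * \<theta> k) \<le> n / \<tau> * ((1 - \<theta> k) * \<theta> j)"
    using n_pos tau_pos by (intro mult_left_mono) auto
  moreover have "n / \<tau> * ((1 - \<tau> / n) * \<theta> k) = wt (Suc k) - \<theta> k"
    using n_pos tau_pos by (simp add: field_simps)
  moreover have "n / \<tau> * ((1 - \<theta> k) * \<theta> j) = (1 - \<theta> k) * wt k"
    by (simp add: Suc del: approx_theta.simps)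
  ultimately show ?thesis by linarith
qed

lemma mix_feasible:
  "z \<in> feasible \<Longrightarrow> w \<in> feasible \<Longrightarrow> z + block_restrict blk T (w - z) \<in> feasible"
  by (simp add: feasible_iff block_part_mix)

lemma W_feasible: "solvable_at h \<Longrightarrow> W h \<in> feasible"
  unfolding W_def solvable_at_def by (rule full_step_three_point)

lemma x0_feasible: "x0 \<in> feasible"
  using x0_dom by (simp add: feasible_def)

text \<open>\<open>X h\<close> is a convex combination of the points \<open>Z\<close> along the history, in which \<open>Z h\<close> has
  weight \<open>wt (length h)\<close>, and \<open>psihat h\<close> is the same combination of the values of \<open>P\<close>;
  \<open>p\<close> collects the earlier points.\<close>

lemma state_convex_combination:
  assumes "solvable_along h"
  shows "Z h \<in> feasible \<and> (\<exists>p\<in>feasible.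
    X h = wt (length h) *\<^sub>R Z h + (1 - wt (length h)) *\<^sub>R p \<and>
    wt (length h) * P (Z h) + (1 - wt (length h)) * P p \<le> psihat h)"
  using assms
proof (induction h)
  case Nil
  then show ?case using x0_feasible by (auto simp: state_Nil)
next
  case (Cons T h)
  define k where "k = length h"
  define a where "a = n / \<tau> * \<theta> k"
  from Cons obtain p where p: "p \<in> feasible" and Z: "Z h \<in> feasible"
    and X: "X h = wt k *\<^sub>R Z h + (1 - wt k) *\<^sub>R p"
    and le: "wt k * P (Z h) + (1 - wt k) * P p \<le> psihat h"
    by (auto simp: k_def)
  have Z': "Z (T # h) \<in> feasible"
    unfolding state_Cons using Z W_feasible Cons.prems by (intro mix_feasible) auto
  \<comment> \<open>The coefficients that \<open>Z h\<close> and the old \<open>p\<close> receive in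
    \<open>X (T # h)\<close>. They sum to \<open>1 - a\<close>, and the merged point
    \<open>q\<close> becomes the new \<open>p\<close>.\<close>
  define \<alpha> \<beta> where "\<alpha> = (1 - \<theta> k) * wt k + \<theta> k - a" and "\<beta> = (1 - \<theta> k) * (1 - wt k)"
  have "0 \<le> \<alpha>" "0 \<le> \<beta>"
    using wt_step[of k] wt_bounds[of k] theta_le_1[of k] by (auto simp: \<alpha>_def \<beta>_def a_def)
  then obtain q where q: "q \<in> feasible" "\<alpha> *\<^sub>R Z h + \<beta> *\<^sub>R p = (\<alpha> + \<beta>) *\<^sub>R q"
      "(\<alpha> + \<beta>) * P q \<le> \<alpha> * P (Z h) + \<beta> * P p"
    by (rule convex_on_merge[OF P_convex p Z])
  have sum: "\<alpha> + \<beta> = 1 - a" by (simp add: \<alpha>_def \<beta>_def algebra_simps)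
  have "X (T # h) = a *\<^sub>R Z (T # h) + (\<alpha> *\<^sub>R Z h + \<beta> *\<^sub>R p)"
    unfolding state_Cons(2) Y_def k_def[symmetric] X
    by (simp add: \<alpha>_def \<beta>_def a_def algebra_simps)
  moreover have "a * P (Z (T # h)) + (1 - a) * P q \<le> psihat (T # h)"
  proof -
    have "(1 - \<theta> k) * (wt k * P (Z h) + (1 - wt k) * P p) \<le> (1 - \<theta> k) * psihat h"
      using le theta_le_1[of k] by (intro mult_left_mono) auto
    moreover have "psihat (T # h) =
        (1 - \<theta> k) * psihat h + (\<theta> k - a) * P (Z h) + a * P (Z (T # h))"
      by (simp add: k_def a_def)
    ultimately show ?thesis
      using q(3) unfolding sum by (simp add: \<alpha>_def \<beta>_def algebra_simps)
  qed
  ultimately show ?case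
    using Z' q sum by (auto simp: k_def a_def)
qed

lemma P_X_le_psihat:
  assumes "solvable_along h"
  shows "X h \<in> feasible" "P (X h) \<le> psihat h"
proof -
  define a where "a = wt (length h)"
  obtain p where *: "p \<in> feasible" "Z h \<in> feasible" "X h = a *\<^sub>R Z h + (1 - a) *\<^sub>R p"
    "a * P (Z h) + (1 - a) * P p \<le> psihat h"
    using state_convex_combination[OF assms] by (auto simp: a_def)
  have a: "0 \<le> a" "0 \<le> 1 - a" using wt_bounds by (auto simp: a_def)
  obtain q where "q \<in> feasible" "a *\<^sub>R Z h + (1 - a) *\<^sub>R p = (a + (1 - a)) *\<^sub>R q"
    "(a + (1 - a)) * P q \<le> a * P (Z h) + (1 - a) * P p"
    by (rule convex_on_merge[OF P_convex *(1,2) a])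
  then show "X h \<in> feasible" "P (X h) \<le> psihat h" using * by auto
qed

section \<open>Expected decrease in one iteration\<close>

abbreviation "E \<equiv> measure_pmf.expectation Shat"

definition gap :: "'b set list \<Rightarrow> real" where
  "gap h = f (X h) + psihat h - (f xs + P xs)"

lemma integrable_Shat: "integrable (measure_pmf Shat) (g :: 'b set \<Rightarrow> real)"
  by (rule integrable_measure_pmf_finite) simp

lemma block_restrict_scaleR: "block_restrict blk T (c *\<^sub>R u) = c *\<^sub>R block_restrict blk T u"
  by (simp add: block_restrict_def block_part_simps scaleR_sum_right)

lemma gap_step:
  assumes solvable_along: "solvable_along h" and solv: "solvable_at h"
  defines "t \<equiv> \<theta> (length h)"
  shows "E (\<lambda>T. gap (T # h)) + n\<^sup>2 * t\<^sup>2 / (2 * \<tau>\<^sup>2) * E (\<lambda>T. N (Z (T # h) - xs)) \<le>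
    (1 - t) * gap h + n\<^sup>2 * t\<^sup>2 / (2 * \<tau>\<^sup>2) * N (Z h - xs)"
proof -
  define x y z w where "x = X h" and "y = Y h" and "z = Z h" and "w = W h"
  define a where "a = n / \<tau> * t"
  define c where "c = n * t\<^sup>2 / (2 * \<tau>)"
  have t: "0 < t" "t \<le> 1" using theta_pos theta_le_1 by (auto simp: t_def)
  have z: "z \<in> feasible" using state_convex_combination[OF solvable_along] by (simp add: z_def)
  have w: "w \<in> feasible" using W_feasible[OF solv] by (simp add: w_def)
  have three_point: "P w + gradf y \<bullet> (w - y) + n * t / (2 * \<tau>) * N (w - z) + n * t / (2 * \<tau>) * N (w - xs)
      \<le> P xs + gradf y \<bullet> (xs - y) + n * t / (2 * \<tau>) * N (z - xs)"
    using full_step_three_point(2)[OF solv[unfolded solvable_at_def]]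
    by (simp add: w_def y_def z_def t_def W_def)
  have Z': "Z (T # h) = z + block_restrict blk T (w - z)" for T
    by (simp add: state_Cons z_def w_def)
  have X': "X (T # h) = y + block_restrict blk T (a *\<^sub>R (w - z))" for T
    by (simp add: state_Cons z_def w_def y_def a_def t_def block_restrict_scaleR)
  \<comment> \<open>The overapproximation is applied with direction
    \<open>a *\<^sub>R (w - z)\<close>; its factor \<open>\<tau> / n\<close> cancels the
    \<open>n / \<tau>\<close> in \<open>a\<close> and leaves \<open>t\<close> on the linear
    term.\<close>
  have "E (\<lambda>T. f (X (T # h))) \<le> f y + \<tau> / n * (gradf y \<bullet> (a *\<^sub>R (w - z)) + 1 / 2 * N (a *\<^sub>R (w - z)))"
    unfolding X' by (rule ESO)
  also have "\<dots> = f y + t * (gradf y \<bullet> (w - z)) + c * N (w - z)"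
    unfolding norm_v_sq_scaleR inner_scaleR_right
    using n_pos tau_pos by (simp add: a_def c_def field_simps power2_eq_square)
  also have "f y + t * (gradf y \<bullet> (w - z)) \<le> (1 - t) * f x + t * (f y + gradf y \<bullet> (w - y))"
  proof -
    \<comment> \<open>The definition of \<open>y\<close>, rearranged: the slope along
      \<open>y - z\<close> is traded for one along \<open>x - y\<close>, which convexity
      bounds.\<close>
    have "t *\<^sub>R (y - z) = (1 - t) *\<^sub>R (x - y)"
      by (simp add: y_def Y_def x_def z_def t_def algebra_simps)
    then have "t * (gradf y \<bullet> (y - z)) = (1 - t) * (gradf y \<bullet> (x - y))"
      by (metis inner_scaleR_right)
    moreover have "gradf y \<bullet> (w - z) = gradf y \<bullet> (w - y) + gradf y \<bullet> (y - z)"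
      by (simp add: inner_simps)
    moreover have "(1 - t) * (f y + gradf y \<bullet> (x - y)) \<le> (1 - t) * f x"
      using t convex_on_above_gradient[OF f_convex f_grad] by (intro mult_left_mono) auto
    ultimately show ?thesis by (simp add: algebra_simps)
  qed
  finally have E_f: "E (\<lambda>T. f (X (T # h))) \<le>
      (1 - t) * f x + t * (f y + gradf y \<bullet> (w - y)) + c * N (w - z)" by simp
  have E_P: "E (\<lambda>T. P (Z (T # h))) = (1 - \<tau> / n) * P z + \<tau> / n * P w"
    using expectation_block_mix[OF prob_mem, where g = "\<lambda>i u. real_of_ereal (\<psi> i u)" and z = z and w = w]
    by (simp add: Z' block_sum_eq(2) z w mix_feasible)
  have E_N: "E (\<lambda>T. N (Z (T # h) - xs)) = (1 - \<tau> / n) * N (z - xs) + \<tau> / n * N (w - xs)"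
    using expectation_block_mix[OF prob_mem,
        where g = "\<lambda>i u. v i * (block_norm B i (u - bp i xs))\<^sup>2" and z = z and w = w]
    by (simp add: Z' norm_v_sq_def block_part_simps)
  have "E (\<lambda>T. psihat (T # h)) = (1 - t) * psihat h + (t - a) * P z + a * E (\<lambda>T. P (Z (T # h)))"
    by (simp add: integrable_Shat t_def a_def z_def)
  \<comment> \<open>As \<open>a * \<tau> / n = t\<close>, the terms in \<open>P z\<close> cancel
    exactly and \<open>P w\<close> keeps the weight \<open>t\<close>.\<close>
  also have "\<dots> = (1 - t) * psihat h + t * P w"
    unfolding E_P using n_pos tau_pos by (simp add: a_def field_simps)
  finally have E_psihat: "E (\<lambda>T. psihat (T # h)) = (1 - t) * psihat h + t * P w" .
  have E_gap: "E (\<lambda>T. gap (T # h)) =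
      E (\<lambda>T. f (X (T # h))) + E (\<lambda>T. psihat (T # h)) - (f xs + P xs)"
    by (simp add: gap_def integrable_Shat del: psihat.simps)
  \<comment> \<open>Scaling the three-point inequality by \<open>t\<close> turns its proximal
    coefficient into \<open>c\<close>, so its \<open>N (w - z)\<close> absorbs the one from the
    overapproximation.\<close>
  have c: "c = t * (n * t / (2 * \<tau>))" by (simp add: c_def power2_eq_square)
  have "t * (P w + gradf y \<bullet> (w - y)) + c * N (w - z) + c * N (w - xs)
      \<le> t * (P xs + gradf y \<bullet> (xs - y)) + c * N (z - xs)"
    using mult_left_mono[OF three_point, of t] t by (simp add: c distrib_left mult.assoc)
  moreover have "t * (f y + gradf y \<bullet> (xs - y)) \<le> t * f xs"
    using t convex_on_above_gradient[OF f_convex f_grad] by (intro mult_left_mono) auto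
  moreover have "n\<^sup>2 * t\<^sup>2 / (2 * \<tau>\<^sup>2) * E (\<lambda>T. N (Z (T # h) - xs)) =
      n\<^sup>2 * t\<^sup>2 / (2 * \<tau>\<^sup>2) * N (z - xs) - c * N (z - xs) + c * N (w - xs)"
    unfolding E_N using n_pos tau_pos by (simp add: c_def field_simps power2_eq_square)
  ultimately have "E (\<lambda>T. gap (T # h)) + n\<^sup>2 * t\<^sup>2 / (2 * \<tau>\<^sup>2) * E (\<lambda>T. N (Z (T # h) - xs)) \<le>
      (1 - t) * f x + (1 - t) * psihat h - (1 - t) * (f xs + P xs) + n\<^sup>2 * t\<^sup>2 / (2 * \<tau>\<^sup>2) * N (z - xs)"
    using E_f unfolding E_gap E_psihat by (simp add: algebra_simps)
  then show ?thesis
    by (simp add: gap_def x_def z_def algebra_simps)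
qed

section \<open>Telescoping and the rate in expectation\<close>

definition "C0 = (1 - \<tau> / n) * (f x0 + P x0 - (f xs + P xs)) + 1 / 2 * N (x0 - xs)"

abbreviation EH :: "nat \<Rightarrow> ('b set list \<Rightarrow> real) \<Rightarrow> real" where
  "EH k \<equiv> measure_pmf.expectation (replicate_pmf k Shat)"

lemma finite_histories: "finite (set_pmf (replicate_pmf k Shat))"
  by (rule finite_subset[OF _ finite_lists_length_eq[of UNIV k]]) (auto simp: set_replicate_pmf)

lemma integrable_histories: "integrable (measure_pmf (replicate_pmf k Shat)) (g :: 'b set list \<Rightarrow> real)"
  by (rule integrable_measure_pmf_finite[OF finite_histories])

lemma solvable_along_histories:
  assumes "\<And>h. set h \<subseteq> set_pmf Shat \<Longrightarrow> solvable_at h"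
  shows "set h \<subseteq> set_pmf Shat \<Longrightarrow> solvable_along h"
  using assms by (induction h) auto

text \<open>The one-step inequality averaged over all histories of length \<open>k\<close>, by the
  tower property.\<close>

lemma expected_gap_step:
  assumes solv: "\<And>h. set h \<subseteq> set_pmf Shat \<Longrightarrow> solvable_at h"
  shows "EH (Suc k) gap + n\<^sup>2 * (\<theta> k)\<^sup>2 / (2 * \<tau>\<^sup>2) * EH (Suc k) (\<lambda>h. N (Z h - xs)) \<le>
    (1 - \<theta> k) * EH k gap + n\<^sup>2 * (\<theta> k)\<^sup>2 / (2 * \<tau>\<^sup>2) * EH k (\<lambda>h. N (Z h - xs))"
proof -
  let ?b = "n\<^sup>2 * (\<theta> k)\<^sup>2 / (2 * \<tau>\<^sup>2)"
  have "EH k (\<lambda>h. E (\<lambda>T. gap (T # h)) + ?b * E (\<lambda>T. N (Z (T # h) - xs)))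
      \<le> EH k (\<lambda>h. (1 - \<theta> k) * gap h + ?b * N (Z h - xs))"
  proof (intro integral_mono_AE integrable_histories AE_pmfI)
    fix h assume "h \<in> set_pmf (replicate_pmf k Shat)"
    then have h: "set h \<subseteq> set_pmf Shat" "length h = k" by (auto simp: set_replicate_pmf)
    show "E (\<lambda>T. gap (T # h)) + ?b * E (\<lambda>T. N (Z (T # h) - xs)) \<le> (1 - \<theta> k) * gap h + ?b * N (Z h - xs)"
      using gap_step[OF solvable_along_histories[OF solv h(1)] solv[OF h(1)]] by (simp add: h(2))
  qed
  then show ?thesis
    by (simp add: expectation_replicate_pmf_Suc integrable_histories del: replicate_pmf.simps)
qed

text \<open>Dividing the step by \<open>\<theta>\<^sub>k\<^sup>2\<close> makes it telescope, because
  \<open>(1 - \<theta>\<^sub>k\<^sub>+\<^sub>1) / \<theta>\<^sub>k\<^sub>+\<^sub>1\<^sup>2 = 1 / \<theta>\<^sub>k\<^sup>2\<close>.\<close>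

lemma expected_gap_telescope:
  assumes solv: "\<And>h. set h \<subseteq> set_pmf Shat \<Longrightarrow> solvable_at h"
  shows "EH (Suc k) gap / (\<theta> k)\<^sup>2 + n\<^sup>2 / (2 * \<tau>\<^sup>2) * EH (Suc k) (\<lambda>h. N (Z h - xs)) \<le> n\<^sup>2 / \<tau>\<^sup>2 * C0"
proof (induction k)
  case 0
  \<comment> \<open>Since \<open>\<theta> 0 = \<tau> / n\<close>, the distance to \<open>xs\<close>
    enters with coefficient \<open>1/2\<close>, and the right-hand side of the step is exactly
    \<open>C0\<close>.\<close>
  have "EH 1 gap + n\<^sup>2 * (\<tau> / n)\<^sup>2 / (2 * \<tau>\<^sup>2) * EH 1 (\<lambda>h. N (Z h - xs)) \<le> C0"
    using expected_gap_step[OF solv, of 0] n_pos tau_pos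
    by (simp add: C0_def gap_def state_Nil field_simps power2_eq_square del: replicate_pmf.simps(2))
  then have "n\<^sup>2 / \<tau>\<^sup>2 * (EH 1 gap + n\<^sup>2 * (\<tau> / n)\<^sup>2 / (2 * \<tau>\<^sup>2) * EH 1 (\<lambda>h. N (Z h - xs))) \<le> n\<^sup>2 / \<tau>\<^sup>2 * C0"
    by (intro mult_left_mono) auto
  then show ?case
    using n_pos tau_pos by (simp add: field_simps power2_eq_square del: replicate_pmf.simps(2))
next
  case (Suc k)
  define e r where "e = EH (Suc (Suc k)) gap" and "r = EH (Suc (Suc k)) (\<lambda>h. N (Z h - xs))"
  define e0 r0 where "e0 = EH (Suc k) gap" and "r0 = EH (Suc k) (\<lambda>h. N (Z h - xs))"
  define t where "t = \<theta> (Suc k)"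
  have t: "t > 0" "t\<^sup>2 = (1 - t) * (\<theta> k)\<^sup>2"
    unfolding t_def using theta_pos approx_theta_Suc_sq[OF theta_init(1)] by blast+
  have "e + n\<^sup>2 * t\<^sup>2 / (2 * \<tau>\<^sup>2) * r \<le> (1 - t) * e0 + n\<^sup>2 * t\<^sup>2 / (2 * \<tau>\<^sup>2) * r0"
    using expected_gap_step[OF solv, of "Suc k"] unfolding e_def r_def e0_def r0_def t_def .
  then have "(e + n\<^sup>2 * t\<^sup>2 / (2 * \<tau>\<^sup>2) * r) / t\<^sup>2 \<le> ((1 - t) * e0 + n\<^sup>2 * t\<^sup>2 / (2 * \<tau>\<^sup>2) * r0) / t\<^sup>2"
    by (intro divide_right_mono) auto
  then have "e / t\<^sup>2 + n\<^sup>2 / (2 * \<tau>\<^sup>2) * r \<le> (1 - t) / t\<^sup>2 * e0 + n\<^sup>2 / (2 * \<tau>\<^sup>2) * r0"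
    using t(1) by (simp add: add_divide_distrib)
  also have "(1 - t) / t\<^sup>2 = 1 / (\<theta> k)\<^sup>2"
  proof -
    \<comment> \<open>\<open>t = 1\<close> would force \<open>t\<^sup>2 = 0\<close>.\<close>
    have "t \<noteq> 1" using t by auto
    then show ?thesis unfolding t(2) by simp
  qed
  finally show ?case
    using Suc.IH unfolding e_def r_def e0_def r0_def t_def by simp
qed

text \<open>The distance term is nonnegative and is dropped. A history of length \<open>k\<close>
  has \<open>\<theta> (k - 1)\<close> in the telescoped inequality, whence the \<open>k - 1\<close>
  in the denominator; nonnegativity of \<open>C0\<close> permits inserting the upper bound for this
  parameter.\<close>

lemma expected_gap_bound:
  assumes solv: "\<And>h. set h \<subseteq> set_pmf Shat \<Longrightarrow> solvable_at h" and "k \<ge> 1"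
  shows "EH k gap \<le> 4 * n\<^sup>2 / ((real k - 1) * \<tau> + 2 * n)\<^sup>2 * C0"
proof -
  obtain j where k: "k = Suc j" using \<open>k \<ge> 1\<close> by (cases k) auto
  have "C0 \<ge> 0"
    using theta_init(2) norm_v_sq_nonneg[where v = v, OF v_pos] xs_min[of x0]
    by (auto simp: C0_def objective_eq xs_feasible x0_feasible intro!: add_nonneg_nonneg)
  have "EH k (\<lambda>h. N (Z h - xs)) \<ge> 0"
    by (intro integral_nonneg_AE) (auto intro: norm_v_sq_nonneg[OF v_pos])
  then have "EH k gap / (\<theta> j)\<^sup>2 \<le> n\<^sup>2 / \<tau>\<^sup>2 * C0"
    using expected_gap_telescope[OF solv, of j] unfolding k
    by (smt (verit) divide_nonneg_nonneg mult_nonneg_nonneg zero_le_power2)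
  then have "EH k gap \<le> (\<theta> j)\<^sup>2 * (n\<^sup>2 / \<tau>\<^sup>2 * C0)"
    using theta_pos[of j] by (simp add: field_simps)
  also have "\<dots> \<le> (2 / (real j + 2 / (\<tau> / n)))\<^sup>2 * (n\<^sup>2 / \<tau>\<^sup>2 * C0)"
    using approx_theta_le[OF theta_init(1), of j] theta_pos[of j] \<open>C0 \<ge> 0\<close>
    by (intro mult_right_mono power_mono) (auto intro: less_imp_le)
  also have "2 / (real j + 2 / (\<tau> / n)) = 2 * \<tau> / (real j * \<tau> + 2 * n)"
    using tau_pos n_pos by (simp add: field_simps)
  also have "(2 * \<tau> / (real j * \<tau> + 2 * n))\<^sup>2 * (n\<^sup>2 / \<tau>\<^sup>2 * C0) =
      4 * n\<^sup>2 / ((real k - 1) * \<tau> + 2 * n)\<^sup>2 * C0"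
    using tau_pos by (simp add: k power_divide power_mult_distrib)
  finally show ?thesis .
qed

section \<open>From histories to the random iterates\<close>

text \<open>Induction on \<open>k\<close>, comparing \<open>z (Suc k)\<close> block by block:
  unsampled blocks are kept, sampled ones agree by uniqueness of the minimizer.\<close>

lemma approx_run_state:
  assumes run: "approx_run blk gradf \<psi> B v \<tau> x0 Ss x y z"
  defines "H \<equiv> \<lambda>k. map Ss (rev [0..<k])"
  shows "x k = X (H k)" "z k = Z (H k)"
    and "\<And>i. i \<in> Ss k \<Longrightarrow> block_argmin k (Y (H k)) (Z (H k)) i (block_part blk i (z (Suc k)))"
proof -
  have x0: "x 0 = x0" "z 0 = x0"
    and y: "\<And>k. y k = (1 - \<theta> k) *\<^sub>R x k + \<theta> k *\<^sub>R z k"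
    and keep: "\<And>k i. i \<notin> Ss k \<Longrightarrow> bp i (z (Suc k)) = bp i (z k)"
    and argmin: "\<And>k i. i \<in> Ss k \<Longrightarrow> block_argmin k (y k) (z k) i (bp i (z (Suc k)))"
    and x: "\<And>k. x (Suc k) = y k + (n / \<tau> * \<theta> k) *\<^sub>R (z (Suc k) - z k)"
    using run[unfolded approx_run_def Let_def, folded n_def] unfolding block_argmin_def by blast+
  have H_Suc: "H (Suc k) = Ss k # H k" and len: "length (H k) = k" for k
    by (simp_all add: H_def)
  have state: "x k = X (H k) \<and> z k = Z (H k)" for k
  proof (induction k)
    case 0
    then show ?case by (simp add: H_def state_Nil x0)
  next
    case (Suc k)
    then have yk: "y k = Y (H k)" by (simp add: y Y_def len)
    have "z (Suc k) = z k + block_restrict blk (Ss k) (W (H k) - z k)"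
    proof (rule block_part_eqI)
      fix i
      show "bp i (z (Suc k)) = bp i (z k + block_restrict blk (Ss k) (W (H k) - z k))"
        using keep[of i k] block_part_full_step[OF argmin[of i k]] Suc yk
        by (simp add: block_part_mix W_def len)
    qed
    then show ?case
      using Suc yk x[of k] by (simp add: H_Suc state_Cons len)
  qed
  then show "x k = X (H k)" "z k = Z (H k)" by auto
  show "block_argmin k (Y (H k)) (Z (H k)) i (bp i (z (Suc k)))" if "i \<in> Ss k" for i
    using argmin[OF that] state by (simp add: y Y_def len)
qed

lemma expected_objective_bound:
  assumes "prob_space M"
    and indep: "prob_space.indep_vars M (\<lambda>_. count_space UNIV) S UNIV"
    and distr: "\<And>k. distr M (count_space UNIV) (S k) = measure_pmf Shat"
    and run: "\<And>\<omega>. \<omega> \<in> space M \<Longrightarrow> approx_run blk gradf \<psi> B v \<tau> x0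
      (\<lambda>k. S k \<omega>) (\<lambda>k. x k \<omega>) (\<lambda>k. y k \<omega>) (\<lambda>k. z k \<omega>)"
    and "k \<ge> 1"
  shows "(\<integral>\<^sup>+ \<omega>. e2ennreal (objective f blk \<psi> (x k \<omega>) - objective f blk \<psi> xs) \<partial>M)
    \<le> ennreal (4 * n\<^sup>2 / ((real k - 1) * \<tau> + 2 * n)\<^sup>2 * C0)"
proof -
  interpret prob_space M by fact
  let ?F = "objective f blk \<psi>"
  define H where "H k \<omega> = map (\<lambda>i. S i \<omega>) (rev [0..<k])" for k \<omega>
  have H_Suc: "H (Suc k) \<omega> = S k \<omega> # H k \<omega>" for k \<omega> by (simp add: H_def)
  have H_meas: "H k \<in> M \<rightarrow>\<^sub>M count_space UNIV"
    and H_distr: "distr M (count_space UNIV) (H k) = replicate_pmf k Shat" for k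
    using distr_iid_list[OF indep distr] by (simp_all add: H_def[abs_def])
  have run_state: "x k \<omega> = X (H k \<omega>)" "z k \<omega> = Z (H k \<omega>)"
      "\<And>i. i \<in> S k \<omega> \<Longrightarrow> block_argmin k (Y (H k \<omega>)) (Z (H k \<omega>)) i (bp i (z (Suc k) \<omega>))"
    if "\<omega> \<in> space M" for \<omega> k
    using approx_run_state[OF run[OF that]] by (simp_all add: H_def)
  \<comment> \<open>Every block lies in some set \<open>T\<close> of positive probability. Then
    \<open>T # h\<close> also has positive probability, some outcome realizes it, and the run at
    that outcome supplies the minimizer.\<close>
  have solv: "solvable_at h" if h: "set h \<subseteq> set_pmf Shat" for h
    unfolding solvable_at_def solvable_def
  proof
    fix i
    have "measure_pmf.prob Shat {T. i \<in> T} \<noteq> 0"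
      using theta_init(1) by (simp only: prob_mem)
    then obtain T where T: "T \<in> set_pmf Shat" "i \<in> T"
      by (auto simp: measure_pmf_zero_iff)
    let ?k = "length h"
    have "T # h \<in> set_pmf (replicate_pmf (Suc ?k) Shat)"
      using T h unfolding set_replicate_pmf by auto
    then have "emeasure (distr M (count_space UNIV) (H (Suc ?k))) {T # h} \<noteq> 0"
      unfolding H_distr by (simp add: emeasure_pmf_single pmf_eq_0_set_pmf del: replicate_pmf.simps)
    then have "H (Suc ?k) -` {T # h} \<inter> space M \<noteq> {}"
      by (auto simp: emeasure_distr H_meas)
    then obtain \<omega> where "\<omega> \<in> space M" "H (Suc ?k) \<omega> = T # h"
      by blast
    then have "\<omega> \<in> space M" "S ?k \<omega> = T" "H ?k \<omega> = h"
      by (simp_all add: H_Suc)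
    then show "\<exists>t. block_argmin ?k (Y h) (Z h) i t"
      using run_state(3)[of \<omega> i ?k] T(2) by auto
  qed
  have gap: "0 \<le> gap h \<and> e2ennreal (?F (X h) - ?F xs) \<le> ennreal (gap h)"
    if "h \<in> set_pmf (replicate_pmf k Shat)" for h
  proof -
    have "set h \<subseteq> set_pmf Shat" using that by (auto simp: set_replicate_pmf)
    then have "solvable_along h" using solvable_along_histories solv by blast
    note X = P_X_le_psihat[OF this]
    have "?F (X h) - ?F xs = ereal (f (X h) + P (X h) - (f xs + P xs))"
      by (simp add: objective_eq X(1) xs_feasible)
    moreover have "f xs + P xs \<le> f (X h) + P (X h)"
      using xs_min[of "X h"] by (simp add: objective_eq X(1) xs_feasible)
    ultimately show ?thesis
      using X(2) by (simp add: gap_def e2ennreal_ereal ennreal_leI)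
  qed
  \<comment> \<open>Written through the discrete variable \<open>H k\<close>, the integral becomes
    one over the law of histories, where \<open>gap\<close> dominates the integrand.\<close>
  have "(\<integral>\<^sup>+ \<omega>. e2ennreal (?F (x k \<omega>) - ?F xs) \<partial>M) = (\<integral>\<^sup>+ \<omega>. e2ennreal (?F (X (H k \<omega>)) - ?F xs) \<partial>M)"
    by (intro nn_integral_cong) (simp add: run_state)
  also have "\<dots> = (\<integral>\<^sup>+ h. e2ennreal (?F (X h) - ?F xs) \<partial>distr M (count_space UNIV) (H k))"
    by (subst nn_integral_distr[OF H_meas]) auto
  also have "\<dots> \<le> (\<integral>\<^sup>+ h. ennreal (gap h) \<partial>replicate_pmf k Shat)"
    unfolding H_distr using gap by (intro nn_integral_mono_AE AE_pmfI) blast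
  also have "\<dots> = ennreal (EH k gap)"
    using gap by (intro nn_integral_eq_integral integrable_histories AE_pmfI) blast
  also have "\<dots> \<le> ennreal (4 * n\<^sup>2 / ((real k - 1) * \<tau> + 2 * n)\<^sup>2 * C0)"
    by (intro ennreal_leI expected_gap_bound solv \<open>k \<ge> 1\<close>)
  finally show ?thesis .
qed

end

section \<open>Iteration count and conclusion\<close>

text \<open>The choice of \<open>k\<close> makes \<open>(k - 1) * \<tau> + 2 * n\<close> at least
  \<open>2 * n * sqrt (C / \<epsilon>)\<close>; squaring gives the claim. From
  \<open>\<epsilon> \<le> C\<close> the argument of the ceiling is at least 1, so \<open>nat\<close>
  does not truncate.\<close>

lemma iteration_count:
  fixes n \<tau> C \<epsilon> :: real
  assumes "n > 0" "\<tau> > 0" "\<epsilon> > 0" "\<epsilon> \<le> C"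
  defines "k \<equiv> nat \<lceil>2 * n / \<tau> * (sqrt (C / \<epsilon>) - 1) + 1\<rceil>"
  shows "k \<ge> 1" "4 * n\<^sup>2 / ((real k - 1) * \<tau> + 2 * n)\<^sup>2 * C \<le> \<epsilon>"
proof -
  define r where "r = 2 * n / \<tau> * (sqrt (C / \<epsilon>) - 1)"
  have "sqrt (C / \<epsilon>) \<ge> 1" using assms by simp
  then have r: "r \<ge> 0" using assms by (simp add: r_def)
  have k: "k = nat \<lceil>r + 1\<rceil>" by (simp add: k_def r_def)
  show "k \<ge> 1" using r unfolding k by linarith
  have "r \<le> real k - 1" using r unfolding k by linarith
  then have "r * \<tau> + 2 * n \<le> (real k - 1) * \<tau> + 2 * n" using assms by simp
  moreover have "r * \<tau> + 2 * n = 2 * n * sqrt (C / \<epsilon>)"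
    using assms by (simp add: r_def field_simps)
  ultimately have "2 * n * sqrt (C / \<epsilon>) \<le> (real k - 1) * \<tau> + 2 * n" by simp
  moreover have pos: "2 * n * sqrt (C / \<epsilon>) > 0" using assms by simp
  ultimately have le: "(2 * n * sqrt (C / \<epsilon>))\<^sup>2 \<le> ((real k - 1) * \<tau> + 2 * n)\<^sup>2"
    by (intro power_mono) auto
  have sq: "(2 * n * sqrt (C / \<epsilon>))\<^sup>2 = 4 * n\<^sup>2 * C / \<epsilon>"
    using assms by (simp add: power_mult_distrib)
  have "4 * n\<^sup>2 * C \<le> \<epsilon> * ((real k - 1) * \<tau> + 2 * n)\<^sup>2"
    using le assms(3) unfolding sq by (simp add: field_simps)
  moreover have "((real k - 1) * \<tau> + 2 * n)\<^sup>2 > 0"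
    using le pos by (meson less_le_trans zero_less_power)
  ultimately show "4 * n\<^sup>2 / ((real k - 1) * \<tau> + 2 * n)\<^sup>2 * C \<le> \<epsilon>"
    by (simp add: divide_le_eq)
qed

theorem theorem3:
  fixes blk :: "'m::finite \<Rightarrow> 'b::finite"
    and B :: "'b \<Rightarrow> real ^ 'm ^ 'm"
    and v :: "'b \<Rightarrow> real"
    and f :: "real ^ 'm \<Rightarrow> real"
    and gradf :: "real ^ 'm \<Rightarrow> real ^ 'm"
    and \<psi> :: "'b \<Rightarrow> real ^ 'm \<Rightarrow> ereal"
    and Shat :: "'b set pmf"
    and M :: "'w measure"
    and S :: "nat \<Rightarrow> 'w \<Rightarrow> 'b set"
    and x y z :: "nat \<Rightarrow> 'w \<Rightarrow> real ^ 'm"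
    and x0 xs :: "real ^ 'm"
    and n \<tau> C :: real
    and F :: "real ^ 'm \<Rightarrow> ereal"
  assumes n_def: "n = real CARD('b)"
    and B: "\<And>i. block_spd blk i (B i)"
    and f_convex: "convex_on UNIV f"
    and f_grad: "\<And>u. GDERIV f u :> gradf u"
    and uniform: "uniform_sampling Shat"
    and tau: "\<tau> = measure_pmf.expectation Shat (\<lambda>T. real (card T))"
    and tau_pos: "\<tau> > 0"
    and v_pos: "\<And>i. v i > 0"
    and ESO: "\<And>u h. measure_pmf.expectation Shat (\<lambda>T. f (u + block_restrict blk T h))
                \<le> f u + \<tau> / n * (gradf u \<bullet> h + 1 / 2 * norm_v_sq blk B v h)"
    and psi_convex: "\<And>i. ereal_convex_on (block_space blk i) (\<psi> i)"
    and F_def: "F = objective f blk \<psi>"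
    and x0_dom: "block_sum blk \<psi> x0 < \<infinity>"
    and M: "prob_space M"
    and S_indep: "prob_space.indep_vars M (\<lambda>_. count_space UNIV) S UNIV"
    and S_distr: "\<And>k. distr M (count_space UNIV) (S k) = measure_pmf Shat"
    and run: "\<And>\<omega>. \<omega> \<in> space M \<Longrightarrow>
                approx_run blk gradf \<psi> B v \<tau> x0
                  (\<lambda>k. S k \<omega>) (\<lambda>k. x k \<omega>) (\<lambda>k. y k \<omega>) (\<lambda>k. z k \<omega>)"
    and xs_min: "\<And>u. F xs \<le> F u"
    and C_def: "C = (1 - \<tau> / n) * real_of_ereal (F x0 - F xs) + 1 / 2 * norm_v_sq blk B v (x0 - xs)"
  shows "(\<forall>k\<ge>1. (\<integral>\<^sup>+ \<omega>. e2ennreal (F (x k \<omega>) - F xs) \<partial>M)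
            \<le> ennreal (4 * n\<^sup>2 / ((real k - 1) * \<tau> + 2 * n)\<^sup>2 * C))
       \<and> (\<forall>\<epsilon>>0. \<epsilon> \<le> C \<longrightarrow>
            (\<integral>\<^sup>+ \<omega>. e2ennreal (F (x (nat \<lceil>2 * n / \<tau> * (sqrt (C / \<epsilon>) - 1) + 1\<rceil>) \<omega>) - F xs) \<partial>M)
            \<le> ennreal \<epsilon>)"
proof -
  interpret approx_setup blk B v f gradf \<psi> Shat x0 xs n \<tau>
    by unfold_locales (use assms in \<open>simp_all only: F_def\<close>)
  have "C = C0"
    by (simp add: C_def C0_def F_def objective_eq x0_feasible xs_feasible)
  then have bound: "(\<integral>\<^sup>+ \<omega>. e2ennreal (F (x k \<omega>) - F xs) \<partial>M)
      \<le> ennreal (4 * n\<^sup>2 / ((real k - 1) * \<tau> + 2 * n)\<^sup>2 * C)" if "k \<ge> 1" for k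
    unfolding F_def using expected_objective_bound[OF M S_indep S_distr run that] by simp
  show ?thesis
  proof (intro conjI allI impI)
    fix \<epsilon> :: real
    assume "\<epsilon> > 0" "\<epsilon> \<le> C"
    note count = iteration_count[OF n_pos tau_pos this]
    show "(\<integral>\<^sup>+ \<omega>. e2ennreal (F (x (nat \<lceil>2 * n / \<tau> * (sqrt (C / \<epsilon>) - 1) + 1\<rceil>) \<omega>) - F xs) \<partial>M)
        \<le> ennreal \<epsilon>"
      using bound[OF count(1)] ennreal_leI[OF count(2)] by (rule order_trans)
  qed (rule bound)
qed

end
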